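(* Let $\Omega\subset\mathbb{R}^3$ be an open set and let $Q\colon\Omega\to\mathcal{S}$ be a smooth solution of the equilibrium equation $$L\Delta Q = 2(\partial_1\varphi)\, Q + 3(\partial_2\varphi)\left(Q^2-\frac{|Q|^2}{3}I\right)\quad\text{in }\Omega,$$ where $\partial_1\varphi,\partial_2\varphi$ are evaluated at $(\mathrm{tr}(Q^2),\mathrm{tr}(Q^3))$. Assume that $Q$ is invariant in one direction: there exists $\nu_0\in\mathbb{S}^2$ such that $\nu_0\cdot\nabla Q\equiv 0$ in $\Omega$. (i) If $Q$ is purely uniaxial (i.e. $Q(x)\in\mathcal{U}$ for all $x\in\Omega$), then $Q$ has constant director in every connected component of $\{Q\neq 0\}=\{x\in\Omega : Q(x)\neq 0\}$. That is, for every connected component $\omega$ of $\{Q\neq 0\}$ there exists $n_0=n_0(\omega)\in\mathbb{S}^2$ such that $$Q(x)=s(x)\left(n_0\otimes n_0-\frac13 I\right)\qquad\forall x\in\omega,$$ for some scalar field $s\colon\Omega\to\mathbb{R}$. (ii) If in addition (to $Q$ being purely uniaxial) $Q$ is real analytic and $\Omega$ is connected, then the director is the same in every connected component of $\{Q\neq 0\}$: there exist $n_0\in\mathbb{S}^2$ and a scalar field $s\colon\Omega\to\mathbb{R}$ such that $$Q(x)=s(x)\left(n_0\otimes n_0-\frac13 I\right)\qquad\forall x\in\Omega.$$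
   Context: $\mathcal{S}=\{Q\in M_3(\mathbb{R}) : Q={}^tQ,\ \mathrm{tr}\,Q=0\}$ is the space of symmetric traceless real $3\times3$ matrices, with norm $|Q|^2=\mathrm{tr}(Q^2)$. $\mathbb{S}^2$ is the unit sphere of $\mathbb{R}^3$, $I$ is the $3\times 3$ identity matrix, and $(n\otimes m)_{ij}=n_im_j$. The set of (at least) uniaxial tensors is $$\mathcal{U}=\left\{ s\left(n\otimes n-\tfrac13 I\right) : s\in\mathbb{R},\ n\in\mathbb{S}^2\right\}\subset\mathcal{S}.$$ $L>0$ is a fixed constant and $\varphi\colon\mathbb{R}\times\mathbb{R}\to\mathbb{R}_+=[0,\infty)$ is a fixed smooth function; $\partial_1\varphi,\partial_2\varphi$ denote its partial derivatives with respect to its first and second variables. The equilibrium equation is the Euler-Lagrange equation of $\int_\Omega\left(\frac L2|\nabla Q|^2+\varphi(\mathrm{tr}(Q^2),\mathrm{tr}(Q^3))\right)dx$. The Laplacian acts entrywise, and $\nu_0\cdot\nabla Q=\sum_k(\nu_0)_k\partial_kQ$. *)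

theory Defs
  imports "HOL-Analysis.Analysis"
begin

definition sym_traceless :: "(real^3^3) set" where
  "sym_traceless = {Q. transpose Q = Q \<and> trace Q = 0}"

definition outer :: "real^3 \<Rightarrow> real^3 \<Rightarrow> real^3^3"  (infixl "\<otimes>\<^sub>v" 75) where
  "n \<otimes>\<^sub>v m = (\<chi> i j. n $ i * m $ j)"

definition uniaxial_tensor :: "real \<Rightarrow> real^3 \<Rightarrow> real^3^3" where
  "uniaxial_tensor s n = s *\<^sub>R (n \<otimes>\<^sub>v n - (1/3) *\<^sub>R mat 1)"

definition uniaxial :: "(real^3^3) set" where
  "uniaxial = {uniaxial_tensor s n | s n. n \<in> sphere 0 1}"

(* |Q|^2 = tr(Q^2), which is the square of the library norm when Q is symmetric *)
definition tensor_norm_sq :: "real^3^3 \<Rightarrow> real" where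
  "tensor_norm_sq Q = trace (Q ** Q)"

fun C_k_on :: "nat \<Rightarrow> ('a::real_normed_vector \<Rightarrow> 'b::real_normed_vector) \<Rightarrow> 'a set \<Rightarrow> bool" where
  "C_k_on 0 f S \<longleftrightarrow> continuous_on S f"
| "C_k_on (Suc k) f S \<longleftrightarrow> (\<forall>x\<in>S. f differentiable (at x)) \<and>
     (\<forall>v. C_k_on k (\<lambda>x. frechet_derivative f (at x) v) S)"

(* C-infinity, intended for finite-dimensional domains and open S (derivatives are taken with
   respect to the full space) *)
definition smooth_on :: "('a::real_normed_vector \<Rightarrow> 'b::real_normed_vector) \<Rightarrow> 'a set \<Rightarrow> bool" where
  "smooth_on f S \<longleftrightarrow> (\<forall>k. C_k_on k f S)"

(* Near every point of S, f is the sum of a power series in several variables; the vectors of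
   naturals are the multi-indices, and has_sum is unconditional summation *)
definition real_analytic_on :: "(real^'n \<Rightarrow> 'b::real_normed_vector) \<Rightarrow> (real^'n) set \<Rightarrow> bool" where
  "real_analytic_on f S \<longleftrightarrow>
     (\<forall>a\<in>S. \<exists>r>0. \<exists>c :: nat^'n \<Rightarrow> 'b. ball a r \<subseteq> S \<and>
        (\<forall>x\<in>ball a r.
           ((\<lambda>\<alpha>. (\<Prod>k\<in>UNIV. (x $ k - a $ k) ^ (\<alpha> $ k)) *\<^sub>R c \<alpha>) has_sum f x) UNIV))"

definition partial_deriv :: "'n::finite \<Rightarrow> (real^'n \<Rightarrow> 'b::real_normed_vector) \<Rightarrow> real^'n \<Rightarrow> 'b" where
  "partial_deriv k f x = frechet_derivative f (at x) (axis k 1)"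

definition laplacian :: "(real^'n \<Rightarrow> real) \<Rightarrow> real^'n \<Rightarrow> real" where
  "laplacian f x = (\<Sum>k\<in>UNIV. partial_deriv k (partial_deriv k f) x)"

definition tensor_laplacian :: "(real^3 \<Rightarrow> real^3^3) \<Rightarrow> real^3 \<Rightarrow> real^3^3" where
  "tensor_laplacian Q x = (\<chi> i j. laplacian (\<lambda>y. Q y $ i $ j) x)"

definition equilibrium_eq ::
  "real \<Rightarrow> (real \<Rightarrow> real \<Rightarrow> real) \<Rightarrow> (real^3 \<Rightarrow> real^3^3) \<Rightarrow> (real^3) set \<Rightarrow> bool" where
  "equilibrium_eq L \<phi> Q \<Omega> \<longleftrightarrow> (\<forall>x\<in>\<Omega>.
     let A = Q x;
         t2 = trace (A ** A);
         t3 = trace (A ** A ** A);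
         \<phi>1 = deriv (\<lambda>a. \<phi> a t3) t2;
         \<phi>2 = deriv (\<lambda>b. \<phi> t2 b) t3
     in L *\<^sub>R tensor_laplacian Q x =
          (2 * \<phi>1) *\<^sub>R A + (3 * \<phi>2) *\<^sub>R (A ** A - (tensor_norm_sq A / 3) *\<^sub>R mat 1))"

end

(* Near a point where Q does not vanish, Q = s (n n^T - I/3) with smooth s and n. Comparing the
   entries of the equilibrium equation orthogonal to n gives
   sum_k (d_k n)(d_k n)^T = mu (I - n n^T); as Q depends on two variables only, this says that n is
   conformal, hence a harmonic map to the sphere. The mixed entries then reduce to
   |grad n|^2 grad s = 0. Where grad n does not vanish, s is therefore locally constant, and the
   remaining scalar equation makes |grad n|^2 constant: up to scaling, n would be a local isometry
   from the plane to the sphere, which is impossible. So n is locally constant.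
   In the analytic case, lying in the line spanned by n0 n0^T - I/3 is a linear condition on Q that
   spreads from a ball to all of the connected set by the identity theorem. *)

theory Submission
  imports Defs "HOL-Complex_Analysis.Conformal_Mappings"
begin

section \<open>Directional derivatives of smooth functions\<close>

text \<open>For a uniaxial tensor Q^2 - |Q|^2/3 I = (s/3) Q, so the right-hand side of the
  equilibrium equation, divided by L, is g(s) Q with g a function of s alone. This dependence on s
  alone is what makes |grad n|^2 constant wherever s is constant. The isotropy of grad n is not
  tested against a basis of the tangent plane. With a and b the two derivatives of n, contraction of
  the equation with n, a and b gives relations among |a|^2, |b|^2 and a . b. They force |a| = |b|
  and a . b = 0 even where a or b vanishes, so no case distinction on the rank of grad n arises. A
  director is determined only up to sign, and s and n are constructed only near a given point. What
  is carried from ball to ball is therefore the line through n0 n0^T - I/3; because Q does not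
  vanish, overlapping balls must share this line.\<close>

definition dirderiv :: "'a::real_normed_vector \<Rightarrow> ('a \<Rightarrow> 'b::real_normed_vector) \<Rightarrow> 'a \<Rightarrow> 'b" where
  "dirderiv v f x = frechet_derivative f (at x) v"

lemma dirderiv_eqI: "(f has_derivative f') (at x) \<Longrightarrow> dirderiv v f x = f' v"
  by (simp add: dirderiv_def frechet_derivative_at[symmetric])

lemma differentiable_has_derivative:
  "f differentiable (at x) \<Longrightarrow> (f has_derivative (\<lambda>v. dirderiv v f x)) (at x)"
  by (simp add: dirderiv_def frechet_derivative_works[symmetric])

lemma C_k_on_Suc_iff:
  "C_k_on (Suc k) f S \<longleftrightarrow> (\<forall>x\<in>S. f differentiable (at x)) \<and> (\<forall>v. C_k_on k (dirderiv v f) S)"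
  by (simp add: dirderiv_def[abs_def])

declare C_k_on.simps(2)[simp del]

lemma has_derivative_local_cong:
  assumes "open S" "x \<in> S" "\<And>y. y \<in> S \<Longrightarrow> f y = g y"
  shows "(f has_derivative f') (at x) \<longleftrightarrow> (g has_derivative f') (at x)"
  using assms by (metis has_derivative_transform_within_open)

lemma dirderiv_cong:
  assumes "open S" "x \<in> S" "\<And>y. y \<in> S \<Longrightarrow> f y = g y"
  shows "dirderiv v f x = dirderiv v g x"
  unfolding dirderiv_def frechet_derivative_def
  using has_derivative_local_cong[OF assms] by simp

section \<open>Closure properties of C^k functions on open sets\<close>

text \<open>Openness makes the derivative at a point of S depend on values in S only, and the
  induction passes this on to iterated derivatives.\<close>

lemma C_k_on_cong:
  assumes "open S" "\<And>y. y \<in> S \<Longrightarrow> f y = g y" "C_k_on k f S"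
  shows "C_k_on k g S"
  using assms(2,3)
proof (induction k arbitrary: f g)
  case 0
  then show ?case by (metis C_k_on.simps(1) continuous_on_eq)
next
  case (Suc k)
  have "C_k_on k (dirderiv v g) S" for v
  proof (rule Suc.IH)
    show "dirderiv v f y = dirderiv v g y" if "y \<in> S" for y
      using Suc.prems(1) by (intro dirderiv_cong[OF assms(1) that])
    show "C_k_on k (dirderiv v f) S"
      using Suc.prems(2) by (simp add: C_k_on_Suc_iff)
  qed
  moreover have "g differentiable (at x)" if "x \<in> S" for x
  proof -
    have "f differentiable (at x)"
      using Suc.prems(2) that by (simp add: C_k_on_Suc_iff)
    moreover have "(f has_derivative D) (at x) \<longleftrightarrow> (g has_derivative D) (at x)" for D
      using Suc.prems(1) by (intro has_derivative_local_cong[OF assms(1) that])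
    ultimately show ?thesis
      by (simp add: differentiable_def)
  qed
  ultimately show ?case
    by (simp add: C_k_on_Suc_iff)
qed

lemma C_k_on_lower: "C_k_on (Suc k) f S \<Longrightarrow> C_k_on k f S"
proof (induction k arbitrary: f)
  case 0
  then show ?case
    by (simp add: C_k_on_Suc_iff)
      (meson continuous_at_imp_continuous_on differentiable_imp_continuous_within)
next
  case (Suc k)
  then show ?case using C_k_on_Suc_iff by blast
qed

lemma C_k_on_subset: "C_k_on k f S \<Longrightarrow> T \<subseteq> S \<Longrightarrow> C_k_on k f T"
proof (induction k arbitrary: f)
  case 0
  then show ?case by (auto intro: continuous_on_subset)
next
  case (Suc k)
  then show ?case unfolding C_k_on_Suc_iff by blast
qed

lemma C_k_on_const: "C_k_on k (\<lambda>x. c) S"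
proof (induction k arbitrary: c)
  case (Suc k)
  then show ?case by (simp add: C_k_on_Suc_iff dirderiv_def[abs_def])
qed auto

text \<open>Each closure rule below is an induction on k through this rule: a derivative found by a
  differentiation rule stands in for \<open>frechet_derivative\<close>, and only its values in fixed
  directions have to be C^k.\<close>

lemma C_k_on_SucI:
  assumes "open S" "\<And>x. x \<in> S \<Longrightarrow> (h has_derivative h' x) (at x)"
    and "\<And>v. C_k_on k (\<lambda>x. h' x v) S"
  shows "C_k_on (Suc k) h S"
  unfolding C_k_on_Suc_iff
proof (intro conjI ballI allI)
  show "h differentiable (at x)" if "x \<in> S" for x
    using assms(2)[OF that] by (auto simp: differentiable_def)
  show "C_k_on k (dirderiv v h) S" for v
    by (rule C_k_on_cong[OF assms(1) _ assms(3)[of v]]) (simp add: dirderiv_eqI[OF assms(2)])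
qed

lemma C_k_on_SucD:
  assumes "C_k_on (Suc k) f S"
  shows "x \<in> S \<Longrightarrow> (f has_derivative (\<lambda>v. dirderiv v f x)) (at x)" "C_k_on k (dirderiv v f) S"
  using assms differentiable_has_derivative unfolding C_k_on_Suc_iff by blast+

lemma C_k_on_bounded_linear:
  assumes "bounded_linear h" "open S" "C_k_on k f S"
  shows "C_k_on k (\<lambda>x. h (f x)) S"
  using assms(3)
proof (induction k arbitrary: f)
  case 0
  then show ?case using assms(1) bounded_linear.continuous_on by auto
next
  case (Suc k)
  note f = C_k_on_SucD[OF Suc.prems]
  show ?case
  proof (rule C_k_on_SucI[OF assms(2), where h' = "\<lambda>x v. h (dirderiv v f x)"])
    show "((\<lambda>x. h (f x)) has_derivative (\<lambda>v. h (dirderiv v f x))) (at x)" if "x \<in> S" for x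
      by (rule bounded_linear.has_derivative[OF assms(1) f(1)[OF that]])
    show "C_k_on k (\<lambda>x. h (dirderiv v f x)) S" for v
      by (rule Suc.IH[OF f(2)])
  qed
qed

lemma C_k_on_add:
  assumes "open S" "C_k_on k f S" "C_k_on k g S"
  shows "C_k_on k (\<lambda>x. f x + g x) S"
  using assms(2,3)
proof (induction k arbitrary: f g)
  case 0
  then show ?case by (auto intro: continuous_on_add)
next
  case (Suc k)
  note f = C_k_on_SucD[OF Suc.prems(1)] and g = C_k_on_SucD[OF Suc.prems(2)]
  show ?case
  proof (rule C_k_on_SucI[OF assms(1), where h' = "\<lambda>x v. dirderiv v f x + dirderiv v g x"])
    show "((\<lambda>x. f x + g x) has_derivative (\<lambda>v. dirderiv v f x + dirderiv v g x)) (at x)"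
      if "x \<in> S" for x
      by (rule has_derivative_add[OF f(1)[OF that] g(1)[OF that]])
    show "C_k_on k (\<lambda>x. dirderiv v f x + dirderiv v g x) S" for v
      by (rule Suc.IH[OF f(2) g(2)])
  qed
qed

text \<open>The product rule brings in f and g undifferentiated next to their derivatives, so the
  induction hypothesis is applied with one factor lowered by \<open>C_k_on_lower\<close>. Products,
  scalings, inner products and matrix products are all instances.\<close>

lemma C_k_on_bilinear:
  assumes "bounded_bilinear h" "open S" "C_k_on k f S" "C_k_on k g S"
  shows "C_k_on k (\<lambda>x. h (f x) (g x)) S"
  using assms(3,4)
proof (induction k arbitrary: f g)
  case 0
  then show ?case using bounded_bilinear.continuous_on[OF assms(1)] by auto
next
  case (Suc k)
  note f = C_k_on_SucD[OF Suc.prems(1)] and g = C_k_on_SucD[OF Suc.prems(2)]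
  show ?case
  proof (rule C_k_on_SucI[OF assms(2), where h' = "\<lambda>x v. h (f x) (dirderiv v g x) + h (dirderiv v f x) (g x)"])
    show "((\<lambda>x. h (f x) (g x)) has_derivative (\<lambda>v. h (f x) (dirderiv v g x) + h (dirderiv v f x) (g x))) (at x)"
      if "x \<in> S" for x
      by (rule bounded_bilinear.FDERIV[OF assms(1) f(1)[OF that] g(1)[OF that]])
    show "C_k_on k (\<lambda>x. h (f x) (dirderiv v g x) + h (dirderiv v f x) (g x)) S" for v
      by (rule C_k_on_add[OF assms(2) Suc.IH[OF C_k_on_lower[OF Suc.prems(1)] g(2)]
        Suc.IH[OF f(2) C_k_on_lower[OF Suc.prems(2)]]])
  qed
qed

lemmas C_k_on_mult = C_k_on_bilinear[OF bounded_bilinear_mult]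

text \<open>Differentiation lowers the exponent, hence the induction over all \<open>a\<close> at
  once. The exponent - 1 / 2 later normalises the director.\<close>

lemma C_k_on_powr:
  fixes f :: "'a::real_normed_vector \<Rightarrow> real"
  assumes "open S" "\<And>x. x \<in> S \<Longrightarrow> f x > 0" "C_k_on k f S"
  shows "C_k_on k (\<lambda>x. f x powr a) S"
  using assms(3)
proof (induction k arbitrary: a)
  case 0
  then show ?case using assms(2) by (fastforce intro: continuous_on_powr continuous_on_const)
next
  case (Suc k)
  note f = C_k_on_SucD[OF Suc.prems]
  have "((\<lambda>x. f x powr a) has_derivative (\<lambda>v. a * (f x powr (a - 1) * dirderiv v f x))) (at x)"
    if "x \<in> S" for x
    using has_derivative_compose[OF f(1)[OF that]
      has_real_derivative_powr[OF assms(2)[OF that], unfolded has_field_derivative_def]]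
    by (simp add: mult.assoc)
  moreover have "C_k_on k (\<lambda>x. a * (f x powr (a - 1) * dirderiv v f x)) S" for v
    by (intro C_k_on_mult[OF assms(1)] C_k_on_const Suc.IH[OF C_k_on_lower[OF Suc.prems]] f(2))
  ultimately show ?case
    by (rule C_k_on_SucI[OF assms(1), where h' = "\<lambda>x v. a * (f x powr (a - 1) * dirderiv v f x)"])
qed

text \<open>The derivative is again a product of \<open>inverse (f x)\<close>, the derivative of f
  and a constant, so the induction closes on the same function.\<close>

lemma C_k_on_inverse:
  fixes f :: "'a::real_normed_vector \<Rightarrow> real"
  assumes "open S" "\<And>x. x \<in> S \<Longrightarrow> f x \<noteq> 0" "C_k_on k f S"
  shows "C_k_on k (\<lambda>x. inverse (f x)) S"
  using assms(3)
proof (induction k)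
  case 0
  then show ?case using assms(2) by (auto intro!: continuous_on_inverse)
next
  case (Suc k)
  note f = C_k_on_SucD[OF Suc.prems]
  have "((\<lambda>x. inverse (f x)) has_derivative (\<lambda>v. - 1 * (inverse (f x) * (inverse (f x) * dirderiv v f x)))) (at x)"
    if "x \<in> S" for x
    using has_derivative_compose[OF f(1)[OF that]
      DERIV_inverse[OF assms(2)[OF that], unfolded has_field_derivative_def]]
    by (simp add: power2_eq_square mult.assoc)
  moreover have "C_k_on k (\<lambda>x. - 1 * (inverse (f x) * (inverse (f x) * dirderiv v f x))) S" for v
    by (intro C_k_on_mult[OF assms(1)] C_k_on_const Suc.IH[OF C_k_on_lower[OF Suc.prems]] f(2))
  ultimately show ?case
    by (rule C_k_on_SucI[OF assms(1), where h' = "\<lambda>x v. - 1 * (inverse (f x) * (inverse (f x) * dirderiv v f x))"])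
qed

lemma smooth_on_dirderiv: "smooth_on f S \<Longrightarrow> smooth_on (dirderiv v f) S"
  unfolding smooth_on_def by (intro allI, rule C_k_on_SucD(2)) auto

lemma smooth_on_has_derivative:
  "smooth_on f S \<Longrightarrow> x \<in> S \<Longrightarrow> (f has_derivative (\<lambda>v. dirderiv v f x)) (at x)"
  unfolding smooth_on_def by (rule C_k_on_SucD(1)) auto

lemma smooth_on_imp_continuous_on: "smooth_on f S \<Longrightarrow> continuous_on S f"
  unfolding smooth_on_def by (metis C_k_on.simps(1))

lemma smooth_on_subset: "smooth_on f S \<Longrightarrow> T \<subseteq> S \<Longrightarrow> smooth_on f T"
  unfolding smooth_on_def using C_k_on_subset by blast

lemma smooth_on_const: "smooth_on (\<lambda>x. c) S"
  by (simp add: smooth_on_def C_k_on_const)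

lemma smooth_on_add: "open S \<Longrightarrow> smooth_on f S \<Longrightarrow> smooth_on g S \<Longrightarrow> smooth_on (\<lambda>x. f x + g x) S"
  by (simp add: smooth_on_def C_k_on_add)

lemma smooth_on_sum:
  assumes "open S" "finite I" "\<And>i. i \<in> I \<Longrightarrow> smooth_on (f i) S"
  shows "smooth_on (\<lambda>x. \<Sum>i\<in>I. f i x) S"
  using assms(2,3)
  by (induction I rule: finite_induct) (auto intro: smooth_on_add[OF assms(1)] smooth_on_const)

lemma smooth_on_bounded_linear:
  "bounded_linear h \<Longrightarrow> open S \<Longrightarrow> smooth_on f S \<Longrightarrow> smooth_on (\<lambda>x. h (f x)) S"
  by (simp add: smooth_on_def C_k_on_bounded_linear)

lemma smooth_on_bilinear:
  "bounded_bilinear h \<Longrightarrow> open S \<Longrightarrow> smooth_on f S \<Longrightarrow> smooth_on g S \<Longrightarrow> smooth_on (\<lambda>x. h (f x) (g x)) S"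
  by (simp add: smooth_on_def C_k_on_bilinear)

lemmas smooth_on_mult = smooth_on_bilinear[OF bounded_bilinear_mult]
lemmas smooth_on_scaleR = smooth_on_bilinear[OF bounded_bilinear_scaleR]

lemma smooth_on_powr:
  fixes f :: "'a::real_normed_vector \<Rightarrow> real"
  shows "open S \<Longrightarrow> (\<And>x. x \<in> S \<Longrightarrow> f x > 0) \<Longrightarrow> smooth_on f S \<Longrightarrow> smooth_on (\<lambda>x. f x powr a) S"
  by (simp add: smooth_on_def C_k_on_powr)

lemma smooth_on_inverse:
  fixes f :: "'a::real_normed_vector \<Rightarrow> real"
  shows "open S \<Longrightarrow> (\<And>x. x \<in> S \<Longrightarrow> f x \<noteq> 0) \<Longrightarrow> smooth_on f S \<Longrightarrow> smooth_on (\<lambda>x. inverse (f x)) S"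
  by (simp add: smooth_on_def C_k_on_inverse)

lemma smooth_on_vec_nth: "open S \<Longrightarrow> smooth_on f S \<Longrightarrow> smooth_on (\<lambda>x. f x $ i) S"
  using smooth_on_bounded_linear[OF bounded_linear_vec_nth] .

lemma dirderiv_const [simp]: "dirderiv v (\<lambda>x. c) = (\<lambda>x. 0)"
  by (simp add: dirderiv_def fun_eq_iff)

lemma dirderiv_bilinear:
  assumes "bounded_bilinear h" "smooth_on f S" "smooth_on g S" "x \<in> S"
  shows "dirderiv v (\<lambda>x. h (f x) (g x)) x = h (f x) (dirderiv v g x) + h (dirderiv v f x) (g x)"
  by (rule dirderiv_eqI[OF bounded_bilinear.FDERIV[OF assms(1) smooth_on_has_derivative[OF assms(2,4)]
    smooth_on_has_derivative[OF assms(3,4)]]])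

lemma dirderiv_add:
  assumes "smooth_on f S" "smooth_on g S" "x \<in> S"
  shows "dirderiv v (\<lambda>x. f x + g x) x = dirderiv v f x + dirderiv v g x"
  by (rule dirderiv_eqI[OF has_derivative_add[OF smooth_on_has_derivative[OF assms(1,3)]
    smooth_on_has_derivative[OF assms(2,3)]]])

lemma dirderiv_bounded_linear:
  assumes "bounded_linear h" "smooth_on f S" "x \<in> S"
  shows "dirderiv v (\<lambda>x. h (f x)) x = h (dirderiv v f x)"
  by (rule dirderiv_eqI[OF bounded_linear.has_derivative[OF assms(1) smooth_on_has_derivative[OF assms(2,3)]]])

lemma linear_dirderiv:
  assumes "smooth_on f S" "x \<in> S"
  shows "linear (\<lambda>v. dirderiv v f x)"
  using has_derivative_linear smooth_on_has_derivative[OF assms] .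

lemma dirderiv_add2:
  assumes "open S" "smooth_on f S" "smooth_on g S" "x \<in> S"
  shows "dirderiv w (dirderiv v (\<lambda>x. f x + g x)) x = dirderiv w (dirderiv v f) x + dirderiv w (dirderiv v g) x"
proof -
  have "dirderiv w (dirderiv v (\<lambda>x. f x + g x)) x = dirderiv w (\<lambda>x. dirderiv v f x + dirderiv v g x) x"
    by (rule dirderiv_cong[OF assms(1,4)]) (rule dirderiv_add[OF assms(2,3)])
  then show ?thesis
    by (simp only: dirderiv_add[OF smooth_on_dirderiv[OF assms(2)] smooth_on_dirderiv[OF assms(3)] assms(4)])
qed

lemma dirderiv_bounded_linear2:
  assumes "bounded_linear h" "open S" "smooth_on f S" "x \<in> S"
  shows "dirderiv w (dirderiv v (\<lambda>x. h (f x))) x = h (dirderiv w (dirderiv v f) x)"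
proof -
  have "dirderiv w (dirderiv v (\<lambda>x. h (f x))) x = dirderiv w (\<lambda>x. h (dirderiv v f x)) x"
    by (rule dirderiv_cong[OF assms(2,4)]) (rule dirderiv_bounded_linear[OF assms(1,3)])
  then show ?thesis
    by (simp only: dirderiv_bounded_linear[OF assms(1) smooth_on_dirderiv[OF assms(3)] assms(4)])
qed

lemma dirderiv_bilinear2:
  assumes "bounded_bilinear h" "open S" "smooth_on f S" "smooth_on g S" "x \<in> S"
  shows "dirderiv w (dirderiv v (\<lambda>x. h (f x) (g x))) x =
    h (f x) (dirderiv w (dirderiv v g) x) + h (dirderiv w f x) (dirderiv v g x)
    + h (dirderiv v f x) (dirderiv w g x) + h (dirderiv w (dirderiv v f) x) (g x)"
proof -
  note sm = smooth_on_dirderiv[OF assms(3)] smooth_on_dirderiv[OF assms(4)]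
  have "dirderiv w (dirderiv v (\<lambda>x. h (f x) (g x))) x
      = dirderiv w (\<lambda>x. h (f x) (dirderiv v g x) + h (dirderiv v f x) (g x)) x"
    by (rule dirderiv_cong[OF assms(2,5)]) (rule dirderiv_bilinear[OF assms(1,3,4)])
  also have "\<dots> = dirderiv w (\<lambda>x. h (f x) (dirderiv v g x)) x + dirderiv w (\<lambda>x. h (dirderiv v f x) (g x)) x"
    by (rule dirderiv_add[OF smooth_on_bilinear[OF assms(1,2,3) sm(2)]
      smooth_on_bilinear[OF assms(1,2) sm(1) assms(4)] assms(5)])
  also have "dirderiv w (\<lambda>x. h (f x) (dirderiv v g x)) x
      = h (f x) (dirderiv w (dirderiv v g) x) + h (dirderiv w f x) (dirderiv v g x)"
    by (rule dirderiv_bilinear[OF assms(1,3) sm(2) assms(5)])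
  also have "dirderiv w (\<lambda>x. h (dirderiv v f x) (g x)) x
      = h (dirderiv v f x) (dirderiv w g x) + h (dirderiv w (dirderiv v f) x) (g x)"
    by (rule dirderiv_bilinear[OF assms(1) sm(1) assms(4,5)])
  finally show ?thesis by (simp only: add.assoc)
qed

section \<open>Symmetry of second derivatives\<close>

text \<open>The mean value theorem is applied along v and then along w. The second difference is
  symmetric in v and w, so exchanging them gives Schwarz's theorem. The extra \<open>h\<close> in
  the radius puts the closed parallelogram inside the open ball.\<close>

lemma dirderiv_second_difference:
  fixes f :: "'a::real_normed_vector \<Rightarrow> real"
  assumes "open S" "smooth_on f S" "h > 0" "ball x (h * (norm v + norm w) + h) \<subseteq> S"
  obtains y where "norm (y - x) \<le> h * (norm v + norm w)"
    "f (x + h *\<^sub>R v + h *\<^sub>R w) - f (x + h *\<^sub>R v) - f (x + h *\<^sub>R w) + f x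
      = h * h * dirderiv w (dirderiv v f) y"
proof -
  have bound: "norm (t *\<^sub>R v + u *\<^sub>R w) \<le> h * (norm v + norm w)" if "0 \<le> t" "t \<le> h" "0 \<le> u" "u \<le> h" for t u
  proof -
    have "norm (t *\<^sub>R v + u *\<^sub>R w) \<le> t * norm v + u * norm w"
      using norm_triangle_ineq[of "t *\<^sub>R v" "u *\<^sub>R w"] that by simp
    also have "\<dots> \<le> h * norm v + h * norm w"
      using that by (intro add_mono mult_right_mono) auto
    finally show ?thesis by (simp add: algebra_simps)
  qed
  have inS: "x + (t *\<^sub>R v + u *\<^sub>R w) \<in> S" if "0 \<le> t" "t \<le> h" "0 \<le> u" "u \<le> h" for t u
  proof (rule subsetD[OF assms(4)])
    show "x + (t *\<^sub>R v + u *\<^sub>R w) \<in> ball x (h * (norm v + norm w) + h)"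
      using le_less_trans[OF bound[OF that], of "h * (norm v + norm w) + h"] assms(3)
      by (simp only: mem_ball dist_norm norm_minus_commute[of x] add_diff_cancel_left' less_add_same_cancel1)
  qed
  \<comment> \<open>Keeping \<open>0 *\<^sub>R w\<close> makes both terms instances of one
    differentiation rule and matches \<open>G\<close> at 0.\<close>
  define F where "F t = f (x + (t *\<^sub>R v + h *\<^sub>R w)) - f (x + (t *\<^sub>R v + 0 *\<^sub>R w))" for t
  have dF: "(F has_real_derivative
      dirderiv v f (x + (t *\<^sub>R v + h *\<^sub>R w)) - dirderiv v f (x + (t *\<^sub>R v + 0 *\<^sub>R w))) (at t)"
    if "0 \<le> t" "t \<le> h" for t
  proof -
    have *: "((\<lambda>t. f (x + (t *\<^sub>R v + u *\<^sub>R w))) has_real_derivative dirderiv v f (x + (t *\<^sub>R v + u *\<^sub>R w))) (at t)"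
      if u: "0 \<le> u" "u \<le> h" for u
    proof -
      have "((\<lambda>t. x + (t *\<^sub>R v + u *\<^sub>R w)) has_derivative (\<lambda>r. r *\<^sub>R v)) (at t)"
        by (auto intro!: derivative_eq_intros)
      from has_derivative_compose[OF this smooth_on_has_derivative[OF assms(2) inS]]
      show ?thesis
        using that \<open>0 \<le> t\<close> \<open>t \<le> h\<close> linear_scale[OF linear_dirderiv[OF assms(2) inS[OF \<open>0 \<le> t\<close> \<open>t \<le> h\<close> u]]]
        by (simp add: has_field_derivative_def mult_commute_abs)
    qed
    show ?thesis unfolding F_def
      by (intro DERIV_diff *) (use assms(3) in auto)
  qed
  obtain t where t: "0 < t" "t < h" and
    eq1: "F h - F 0 = (h - 0) * (dirderiv v f (x + (t *\<^sub>R v + h *\<^sub>R w)) - dirderiv v f (x + (t *\<^sub>R v + 0 *\<^sub>R w)))"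
    using MVT2[OF assms(3) dF] by metis
  define G where "G u = dirderiv v f (x + (t *\<^sub>R v + u *\<^sub>R w))" for u
  have dG: "(G has_real_derivative dirderiv w (dirderiv v f) (x + (t *\<^sub>R v + u *\<^sub>R w))) (at u)"
    if "0 \<le> u" "u \<le> h" for u
  proof -
    have mem: "x + (t *\<^sub>R v + u *\<^sub>R w) \<in> S"
      using inS that t by simp
    have "((\<lambda>u. x + (t *\<^sub>R v + u *\<^sub>R w)) has_derivative (\<lambda>r. r *\<^sub>R w)) (at u)"
      by (auto intro!: derivative_eq_intros)
    from has_derivative_compose[OF this smooth_on_has_derivative[OF smooth_on_dirderiv[OF assms(2)] mem]]
    show ?thesis
      unfolding G_def
      using linear_scale[OF linear_dirderiv[OF smooth_on_dirderiv[OF assms(2)] mem]]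
      by (simp add: has_field_derivative_def mult_commute_abs)
  qed
  obtain u where u: "0 < u" "u < h" and
    eq2: "G h - G 0 = (h - 0) * dirderiv w (dirderiv v f) (x + (t *\<^sub>R v + u *\<^sub>R w))"
    using MVT2[OF assms(3) dG] by metis
  show ?thesis
  proof (rule that)
    show "norm ((x + (t *\<^sub>R v + u *\<^sub>R w)) - x) \<le> h * (norm v + norm w)"
      using bound[of t u] t u by simp
    show "f (x + h *\<^sub>R v + h *\<^sub>R w) - f (x + h *\<^sub>R v) - f (x + h *\<^sub>R w) + f x
      = h * h * dirderiv w (dirderiv v f) (x + (t *\<^sub>R v + u *\<^sub>R w))"
      using eq1 eq2 unfolding F_def G_def by (simp add: add.assoc)
  qed
qed

lemma dirderiv_commute_real:
  fixes f :: "'a::real_normed_vector \<Rightarrow> real"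
  assumes "open S" "smooth_on f S" "x \<in> S"
  shows "dirderiv w (dirderiv v f) x = dirderiv v (dirderiv w f) x"
proof (rule ccontr)
  assume neq: "dirderiv w (dirderiv v f) x \<noteq> dirderiv v (dirderiv w f) x"
  define A where "A = dirderiv w (dirderiv v f)"
  define B where "B = dirderiv v (dirderiv w f)"
  \<comment> \<open>Half the gap: \<open>A y = B z\<close> with both values within e of
    \<open>A x\<close> and \<open>B x\<close> respectively would make the gap smaller than
    itself.\<close>
  define e where "e = dist (A x) (B x) / 2"
  have e: "e > 0" using neq by (simp add: e_def A_def B_def)
  have "isCont A x" "isCont B x"
    using smooth_on_imp_continuous_on[of _ S] smooth_on_dirderiv assms
    unfolding A_def B_def by (metis continuous_on_eq_continuous_at)+
  then obtain d1 d2 where d1: "d1 > 0" "\<And>y. dist y x < d1 \<Longrightarrow> dist (A y) (A x) < e"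
    and d2: "d2 > 0" "\<And>y. dist y x < d2 \<Longrightarrow> dist (B y) (B x) < e"
    using e unfolding continuous_at_eps_delta by metis
  obtain d3 where d3: "d3 > 0" "ball x d3 \<subseteq> S"
    using assms openE by blast
  define d where "d = min d1 (min d2 d3)"
  \<comment> \<open>The summand 1 absorbs the extra \<open>h\<close> of the radius and keeps N
    positive when v = w = 0.\<close>
  define N where "N = norm v + norm w + 1"
  define h where "h = d / (2 * N)"
  have N: "N > 0" by (simp add: N_def add_nonneg_pos)
  have d: "d > 0" using d1 d2 d3 by (simp add: d_def)
  have h: "h > 0" using N d by (simp add: h_def)
  have hN: "h * N < d" using N d by (simp add: h_def)
  have le: "h * (norm v + norm w) < d"
    using hN h by (simp add: N_def algebra_simps)
  have sub: "ball x (h * (norm v + norm w) + h) \<subseteq> S" "ball x (h * (norm w + norm v) + h) \<subseteq> S"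
    using hN d3(2) by (auto simp: N_def d_def algebra_simps)
  obtain y where y: "norm (y - x) \<le> h * (norm v + norm w)"
    "f (x + h *\<^sub>R v + h *\<^sub>R w) - f (x + h *\<^sub>R v) - f (x + h *\<^sub>R w) + f x = h * h * A y"
    using dirderiv_second_difference[OF assms(1,2) h sub(1)] unfolding A_def by blast
  obtain z where z: "norm (z - x) \<le> h * (norm w + norm v)"
    "f (x + h *\<^sub>R w + h *\<^sub>R v) - f (x + h *\<^sub>R w) - f (x + h *\<^sub>R v) + f x = h * h * B z"
    using dirderiv_second_difference[OF assms(1,2) h sub(2)] unfolding B_def by blast
  have "h * h * A y = h * h * B z"
    using y(2) z(2) by (simp add: algebra_simps)
  then have "A y = B z" using h by simp
  moreover have "dist (A y) (A x) < e"
    using y(1) le by (intro d1(2)) (simp add: dist_norm d_def)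
  moreover have "dist (B z) (B x) < e"
    using z(1) le by (intro d2(2)) (simp add: dist_norm d_def add.commute)
  ultimately show False
    using dist_triangle[of "A x" "B x" "A y"] by (simp add: e_def dist_commute)
qed

lemma dirderiv_commute:
  fixes f :: "'a::real_normed_vector \<Rightarrow> real^'n"
  assumes "open S" "smooth_on f S" "x \<in> S"
  shows "dirderiv w (dirderiv v f) x = dirderiv v (dirderiv w f) x"
proof -
  have "dirderiv w (dirderiv v f) x $ i = dirderiv v (dirderiv w f) x $ i" for i
    using dirderiv_commute_real[OF assms(1) smooth_on_vec_nth[OF assms(1,2)] assms(3), of w v i]
    by (simp add: dirderiv_bounded_linear2[OF bounded_linear_vec_nth assms])
  then show ?thesis by (simp add: vec_eq_iff)
qed

section \<open>Identity theorem for real analytic functions\<close>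

text \<open>The function is restricted to the line through \<open>z\<close> and \<open>x\<close>, whose parameter is then made complex.
  The series in \<open>c\<close> is dominated by its values at the points \<open>a + \<rho>\<close> with nonnegative \<open>\<rho>\<close>, so it is
  holomorphic on the convex set \<open>D\<close> and the identity theorem in one variable applies.\<close>
lemma power_series_zero_on_ball:
  fixes c :: "nat^'n \<Rightarrow> real" and f :: "real^'n \<Rightarrow> real"
  assumes series: "\<And>x. x \<in> ball a r \<Longrightarrow>
      ((\<lambda>\<alpha>. (\<Prod>k\<in>UNIV. (x $ k - a $ k) ^ (\<alpha> $ k)) *\<^sub>R c \<alpha>) has_sum f x) UNIV"
    and z: "z \<in> ball a r" "d > 0" "\<And>y. y \<in> ball z d \<Longrightarrow> f y = 0"
    and x: "x \<in> ball a r"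
  shows "f x = 0"
proof -
  \<comment> \<open>\<open>w t\<close> holds the coordinates relative to a on the complexified line,
    with z at t = 0 and x at t = 1. For real t, \<open>N t\<close> is the distance from a, so D
    extends to complex parameters the part of the line inside the ball.\<close>
  define w :: "complex \<Rightarrow> 'n \<Rightarrow> complex"
    where "w t k = of_real (z $ k - a $ k) + t * of_real (x $ k - z $ k)" for t k
  define N where "N t = norm (\<chi> k. cmod (w t k))" for t
  define D where "D = {t. N t < r}"
  define F where "F \<alpha> t = (\<Prod>k\<in>UNIV. w t k ^ (\<alpha> $ k)) * of_real (c \<alpha>)" for \<alpha> t
  define H where "H t = (\<Sum>\<^sub>\<infinity>\<alpha>. F \<alpha> t)" for t

  have N_lip: "norm (\<chi> k. cmod (w s k) + e * \<bar>x $ k - z $ k\<bar>) \<le> N s + e * norm (x - z)" if "e \<ge> 0" for s e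
  proof -
    have "(\<chi> k. cmod (w s k) + e * \<bar>x $ k - z $ k\<bar>) = (\<chi> k. cmod (w s k)) + e *\<^sub>R (\<chi> k. \<bar>x $ k - z $ k\<bar>)"
      by (simp add: vec_eq_iff)
    moreover have "norm (\<chi> k. \<bar>x $ k - z $ k\<bar>) = norm (x - z)"
      by (simp add: norm_vec_def)
    ultimately show ?thesis
      unfolding N_def using norm_triangle_ineq[of "\<chi> k. cmod (w s k)" "e *\<^sub>R (\<chi> k. \<bar>x $ k - z $ k\<bar>)"] that
      by simp
  qed
  have "continuous_on UNIV N"
    unfolding N_def w_def by (intro continuous_intros continuous_on_vec_lambda)
  then have "open D"
    unfolding D_def by (intro open_Collect_less continuous_on_const)
  have "convex D"
  proof (rule convexI)
    fix s t :: complex and u v :: real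
    assume st: "s \<in> D" "t \<in> D" and uv: "0 \<le> u" "0 \<le> v" "u + v = 1"
    have "w (u *\<^sub>R s + v *\<^sub>R t) k = u *\<^sub>R w s k + v *\<^sub>R w t k" for k
    proof -
      have "u *\<^sub>R w s k + v *\<^sub>R w t k
          = (u + v) *\<^sub>R of_real (z $ k - a $ k) + (u *\<^sub>R s + v *\<^sub>R t) * of_real (x $ k - z $ k)"
        unfolding w_def by (simp only: scaleR_add_right scaleR_add_left algebra_simps mult_scaleR_left)
      then show ?thesis using uv by (simp add: w_def)
    qed
    then have "cmod (w (u *\<^sub>R s + v *\<^sub>R t) k) \<le> u * cmod (w s k) + v * cmod (w t k)" for k
      using norm_triangle_ineq[of "u *\<^sub>R w s k" "v *\<^sub>R w t k"] uv by simp
    then have "N (u *\<^sub>R s + v *\<^sub>R t) \<le> norm (u *\<^sub>R (\<chi> k. cmod (w s k)) + v *\<^sub>R (\<chi> k. cmod (w t k)))"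
      unfolding N_def using uv by (intro norm_le_componentwise_cart) simp
    also have "\<dots> \<le> u * N s + v * N t"
      unfolding N_def using uv by (intro order_trans[OF norm_triangle_ineq]) simp
    also have "\<dots> < r"
      using st uv by (intro convex_bound_lt) (auto simp: D_def)
    finally show "u *\<^sub>R s + v *\<^sub>R t \<in> D" by (simp add: D_def)
  qed
  have "H analytic_on D"
    unfolding analytic_on_def
  proof
    fix t0 assume t0: "t0 \<in> D"
    \<comment> \<open>Chosen so that a parameter shift by e moves the vector of moduli by at most
      half the gap r - N t0; the summand 1 covers x = z.\<close>
    define e where "e = (r - N t0) / (2 * (norm (x - z) + 1))"
    have pos: "norm (x - z) + 1 > 0" by (simp add: add_nonneg_pos)
    have e: "e > 0" using t0 pos by (simp add: e_def D_def)
    have "e * norm (x - z) \<le> e * (norm (x - z) + 1)"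
      using e by simp
    also have "\<dots> = (r - N t0) / 2"
      using pos unfolding e_def by (simp add: divide_simps)
    also have "\<dots> < r - N t0" using t0 by (simp add: D_def)
    finally have er: "N t0 + e * norm (x - z) < r" by simp
    \<comment> \<open>Coordinatewise bound for \<open>cmod (w t k)\<close> on the whole disc of
      radius e about t0.\<close>
    define \<rho> where "\<rho> k = cmod (w t0 k) + e * \<bar>x $ k - z $ k\<bar>" for k
    have \<rho>: "\<rho> k \<ge> 0" for k using e by (simp add: \<rho>_def)
    define M where "M \<alpha> = (\<Prod>k\<in>UNIV. \<rho> k ^ (\<alpha> $ k)) * \<bar>c \<alpha>\<bar>" for \<alpha> :: "nat^'n"
    have "a + (\<chi> k. \<rho> k) \<in> ball a r"
      using N_lip[of e t0] e er by (simp add: dist_norm \<rho>_def)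
    from series[OF this] have "(\<lambda>\<alpha>. (\<Prod>k\<in>UNIV. \<rho> k ^ (\<alpha> $ k)) * c \<alpha>) summable_on UNIV"
      by (simp add: summable_on_def) blast
    \<comment> \<open>A real family is unconditionally summable only if it is absolutely summable;
      this yields the majorant for the M-test.\<close>
    then have "(\<lambda>\<alpha>. norm ((\<Prod>k\<in>UNIV. \<rho> k ^ (\<alpha> $ k)) * c \<alpha>)) summable_on UNIV"
      by (simp only: summable_on_iff_abs_summable_on_real[symmetric])
    moreover have "norm ((\<Prod>k\<in>UNIV. \<rho> k ^ (\<alpha> $ k)) * c \<alpha>) = M \<alpha>" for \<alpha>
      using \<rho> by (simp add: M_def abs_mult abs_prod power_abs)
    ultimately have summable: "M summable_on UNIV" by simp
    have bound: "norm (F \<alpha> t) \<le> M \<alpha>" if "t \<in> cball t0 e" for \<alpha> t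
    proof -
      have "cmod (w t k) \<le> \<rho> k" for k
      proof -
        have "w t k = w t0 k + (t - t0) * of_real (x $ k - z $ k)"
          by (simp add: w_def algebra_simps)
        then have "cmod (w t k) \<le> cmod (w t0 k) + cmod ((t - t0) * of_real (x $ k - z $ k))"
          by (simp only: norm_triangle_ineq)
        also have "cmod ((t - t0) * of_real (x $ k - z $ k)) = cmod (t - t0) * \<bar>x $ k - z $ k\<bar>"
          by (simp only: norm_mult norm_of_real)
        also have "\<dots> \<le> e * \<bar>x $ k - z $ k\<bar>"
          using that by (intro mult_right_mono) (auto simp: dist_norm norm_minus_commute)
        finally show ?thesis by (simp add: \<rho>_def)
      qed
      then show ?thesis
        unfolding F_def M_def norm_mult norm_of_real
        by (intro mult_right_mono) (auto simp: prod_norm[symmetric] norm_power intro!: prod_mono power_mono)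
    qed
    have lim: "uniform_limit (cball t0 e) (\<lambda>X t. \<Sum>\<alpha>\<in>X. F \<alpha> t) H (finite_subsets_at_top UNIV)"
      unfolding H_def by (rule Weierstrass_m_test_general[OF bound summable])
    have "F \<alpha> holomorphic_on A" for \<alpha> A
      unfolding F_def w_def by (intro holomorphic_intros)
    then have hol: "(\<lambda>t. \<Sum>\<alpha>\<in>X. F \<alpha> t) holomorphic_on A" for X A
      by (intro holomorphic_on_sum)
    have "H holomorphic_on ball t0 e"
      by (rule holomorphic_uniform_limit[OF _ lim])
        (auto intro!: always_eventually hol holomorphic_on_imp_continuous_on)
    then show "\<exists>e>0. H holomorphic_on ball t0 e" using e by blast
  qed
  then have "H holomorphic_on D" by (rule analytic_imp_holomorphic)
  have H_real: "H (of_real t) = of_real (f (z + t *\<^sub>R (x - z)))" "of_real t \<in> D"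
    if "0 \<le> t" "t \<le> 1" for t
  proof -
    have eq: "z + t *\<^sub>R (x - z) = (1 - t) *\<^sub>R z + t *\<^sub>R x"
      by (simp add: algebra_simps)
    have mem: "z + t *\<^sub>R (x - z) \<in> ball a r"
      unfolding eq using that z(1) x by (intro convexD[OF convex_ball]) auto
    have w: "w (of_real t) k = of_real ((z + t *\<^sub>R (x - z)) $ k - a $ k)" for k
      by (simp add: w_def)
    have "((\<lambda>\<alpha>. complex_of_real ((\<Prod>k\<in>UNIV. ((z + t *\<^sub>R (x - z)) $ k - a $ k) ^ (\<alpha> $ k)) *\<^sub>R c \<alpha>))
        has_sum of_real (f (z + t *\<^sub>R (x - z)))) UNIV"
      using series[OF mem] by (rule has_sum_of_real)
    then have "((\<lambda>\<alpha>. F \<alpha> (of_real t)) has_sum of_real (f (z + t *\<^sub>R (x - z)))) UNIV"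
      unfolding F_def w real_scaleR_def of_real_mult of_real_prod of_real_power .
    then show "H (of_real t) = of_real (f (z + t *\<^sub>R (x - z)))"
      unfolding H_def by (rule infsumI)
    have "N (of_real t) = norm (z + t *\<^sub>R (x - z) - a)"
      unfolding N_def w norm_of_real by (simp add: norm_vec_def)
    then show "of_real t \<in> D"
      using mem by (simp add: D_def dist_norm norm_minus_commute)
  qed
  \<comment> \<open>The bound 1 keeps the parameters where \<open>H_real\<close> applies, the other
    bound keeps the points in the ball where f vanishes.\<close>
  define \<delta> where "\<delta> = min 1 (d / (norm (x - z) + 1))"
  have pos: "norm (x - z) + 1 > 0" by (simp add: add_nonneg_pos)
  have \<delta>: "\<delta> > 0" "\<delta> \<le> 1" using z(2) pos by (auto simp: \<delta>_def)
  have small: "f (z + t *\<^sub>R (x - z)) = 0" if "0 < t" "t < \<delta>" for t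
  proof (rule z(3))
    have "t * norm (x - z) \<le> t * (norm (x - z) + 1)"
      using that by simp
    also have "\<dots> < d" using that pos by (simp add: \<delta>_def pos_less_divide_eq)
    finally show "z + t *\<^sub>R (x - z) \<in> ball z d"
      using that by (simp add: dist_norm)
  qed
  have limpt: "(0::complex) islimpt of_real ` {0<..<\<delta>}"
    unfolding islimpt_approachable
  proof (intro allI impI)
    fix e :: real assume "e > 0"
    define t where "t = min \<delta> e / 2"
    have "0 < t" "t < \<delta>" "t < e" using \<delta> \<open>e > 0\<close> by (auto simp: t_def)
    then show "\<exists>y\<in>complex_of_real ` {0<..<\<delta>}. y \<noteq> 0 \<and> dist y 0 < e"
      by (intro bexI[of _ "of_real t"]) auto
  qed
  have "H 1 = 0"
  proof (rule analytic_continuation[OF \<open>H holomorphic_on D\<close> \<open>open D\<close> convex_connected[OF \<open>convex D\<close>] _ _ limpt])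
    show "complex_of_real ` {0<..<\<delta>} \<subseteq> D" using H_real(2) \<delta> by auto
    show "0 \<in> D" "1 \<in> D" using H_real(2)[of 0] H_real(2)[of 1] by simp_all
    show "H t = 0" if "t \<in> complex_of_real ` {0<..<\<delta>}" for t
      using that H_real(1) small \<delta> by auto
  qed
  moreover have "z + 1 *\<^sub>R (x - z) = x" by simp
  ultimately show ?thesis
    using H_real(1)[OF zero_le_one order_refl] by (metis of_real_1 of_real_eq_0_iff)
qed

text \<open>If f vanishes near one point of a ball of expansion, it vanishes on that whole ball.
  Vanishing near a point is thus a locally constant property on S, and connectedness
  concludes.\<close>

lemma real_analytic_on_identity:
  fixes f :: "real^'n \<Rightarrow> real"
  assumes "real_analytic_on f S" "connected S"
    and "z \<in> S" "d > 0" "\<And>y. y \<in> ball z d \<Longrightarrow> f y = 0" and "x \<in> S"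
  shows "f x = 0"
proof -
  define P where "P y \<longleftrightarrow> (\<exists>d>0. \<forall>u\<in>ball y d. f u = 0)" for y
  have "P x"
  proof (rule connected_induction_simple[OF assms(2), of z x P])
    fix a assume "a \<in> S"
    then obtain r c where r: "r > 0" "ball a r \<subseteq> S" and c: "\<And>x. x \<in> ball a r \<Longrightarrow>
      ((\<lambda>\<alpha>. (\<Prod>k\<in>UNIV. (x $ k - a $ k) ^ (\<alpha> $ k)) *\<^sub>R c \<alpha>) has_sum f x) UNIV"
      using assms(1) unfolding real_analytic_on_def by blast
    have "P v" if "u \<in> ball a r" "v \<in> ball a r" "P u" for u v
    proof -
      have "f y = 0" if "y \<in> ball a r" for y
        using power_series_zero_on_ball[OF c \<open>u \<in> ball a r\<close> _ _ that] \<open>P u\<close> unfolding P_def by blast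
      moreover obtain e where "e > 0" "ball v e \<subseteq> ball a r"
        using \<open>v \<in> ball a r\<close> by (metis openE open_ball)
      ultimately show ?thesis unfolding P_def by blast
    qed
    moreover have "openin (top_of_set S) (ball a r)"
      using r by (simp add: open_subset)
    ultimately show "\<exists>T. openin (top_of_set S) T \<and> a \<in> T \<and> (\<forall>x\<in>T. \<forall>y\<in>T. P x \<longrightarrow> P y)"
      using r(1) by (metis centre_in_ball)
  qed (use assms in \<open>auto simp: P_def\<close>)
  then show ?thesis unfolding P_def by (metis centre_in_ball)
qed

lemma real_analytic_on_bounded_linear:
  assumes "bounded_linear h" "real_analytic_on f S"
  shows "real_analytic_on (\<lambda>x. h (f x)) S"
  unfolding real_analytic_on_def
proof
  fix a assume "a \<in> S"
  then obtain r c where r: "r > 0" "ball a r \<subseteq> S" and c: "\<And>x. x \<in> ball a r \<Longrightarrow>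
    ((\<lambda>\<alpha>. (\<Prod>k\<in>UNIV. (x $ k - a $ k) ^ (\<alpha> $ k)) *\<^sub>R c \<alpha>) has_sum f x) UNIV"
    using assms(2) unfolding real_analytic_on_def by blast
  have "((\<lambda>\<alpha>. (\<Prod>k\<in>UNIV. (x $ k - a $ k) ^ (\<alpha> $ k)) *\<^sub>R h (c \<alpha>)) has_sum h (f x)) UNIV"
    if "x \<in> ball a r" for x
    using has_sum_bounded_linear[OF assms(1) c[OF that]]
    by (simp add: linear_scale[OF bounded_linear.linear[OF assms(1)]])
  with r show "\<exists>r>0. \<exists>c. ball a r \<subseteq> S \<and> (\<forall>x\<in>ball a r.
      ((\<lambda>\<alpha>. (\<Prod>k\<in>UNIV. (x $ k - a $ k) ^ (\<alpha> $ k)) *\<^sub>R c \<alpha>) has_sum h (f x)) UNIV)"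
    by (intro exI[of _ r] conjI exI[of _ "\<lambda>\<alpha>. h (c \<alpha>)"]) auto
qed

section \<open>Conformal directors\<close>

text \<open>\<open>c\<close> stands for an entry of - I / 3, so one formula serves diagonal and
  off-diagonal entries; being constant, it survives only next to a derivative of s.\<close>

lemma entry_dirderiv:
  fixes n :: "'a::real_normed_vector \<Rightarrow> real^'n"
  assumes "open V" "smooth_on s V" "smooth_on n V" "x \<in> V"
  shows "dirderiv v (\<lambda>x. s x * (n x $ i * n x $ j + c)) x =
    s x * (n x $ i * dirderiv v n x $ j + dirderiv v n x $ i * n x $ j)
    + dirderiv v s x * (n x $ i * n x $ j + c)"
proof -
  note ni = smooth_on_vec_nth[OF assms(1,3), of i] and nj = smooth_on_vec_nth[OF assms(1,3), of j]
  note nij = smooth_on_mult[OF assms(1) ni nj]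
  note nijc = smooth_on_add[OF assms(1) nij smooth_on_const[of c]]
  show ?thesis
    by (simp only: dirderiv_bilinear[OF bounded_bilinear_mult assms(2) nijc assms(4)]
      dirderiv_bilinear[OF bounded_bilinear_mult ni nj assms(4)]
      dirderiv_add[OF nij smooth_on_const assms(4)] dirderiv_const add_0_right
      dirderiv_bounded_linear[OF bounded_linear_vec_nth assms(3,4)])
qed

lemma entry_dirderiv2:
  fixes n :: "'a::real_normed_vector \<Rightarrow> real^'n"
  assumes "open V" "smooth_on s V" "smooth_on n V" "x \<in> V"
  shows "dirderiv v (dirderiv v (\<lambda>x. s x * (n x $ i * n x $ j + c))) x =
    s x * (n x $ i * dirderiv v (dirderiv v n) x $ j + 2 * (dirderiv v n x $ i * dirderiv v n x $ j)
      + dirderiv v (dirderiv v n) x $ i * n x $ j)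
    + 2 * dirderiv v s x * (n x $ i * dirderiv v n x $ j + dirderiv v n x $ i * n x $ j)
    + dirderiv v (dirderiv v s) x * (n x $ i * n x $ j + c)"
proof -
  note ni = smooth_on_vec_nth[OF assms(1,3), of i] and nj = smooth_on_vec_nth[OF assms(1,3), of j]
  note nij = smooth_on_mult[OF assms(1) ni nj]
  note nijc = smooth_on_add[OF assms(1) nij smooth_on_const[of c]]
  have const2: "dirderiv v (dirderiv v (\<lambda>x. c)) x = 0"
    by simp
  show ?thesis
    unfolding dirderiv_bilinear2[OF bounded_bilinear_mult assms(1) assms(2) nijc assms(4)]
      dirderiv_bilinear2[OF bounded_bilinear_mult assms(1) ni nj assms(4)]
      dirderiv_bilinear[OF bounded_bilinear_mult ni nj assms(4)]
      dirderiv_add[OF nij smooth_on_const assms(4)]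
      dirderiv_add2[OF assms(1) nij smooth_on_const assms(4)] const2
      dirderiv_bounded_linear[OF bounded_linear_vec_nth assms(3,4)]
      dirderiv_bounded_linear2[OF bounded_linear_vec_nth assms(1,3,4)]
    by (simp add: algebra_simps)
qed

text \<open>Multiplying by \<open>u $ i * w $ j\<close> and summing turns nine entries into one
  scalar identity in inner products; the diagonal term becomes u . w / 3.\<close>

lemma quadratic_form_contract:
  fixes m l a b u w :: "real^3"
  assumes "\<And>i j. \<sigma> * (l $ i * m $ j + m $ i * l $ j + 2 * (a $ i * a $ j) + 2 * (b $ i * b $ j))
      + 2 * s1 * (a $ i * m $ j + m $ i * a $ j) + 2 * s2 * (b $ i * m $ j + m $ i * b $ j)
      + k * (m $ i * m $ j + (if i = j then - 1 / 3 else 0)) = 0"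
  shows "\<sigma> * ((l \<bullet> u) * (m \<bullet> w) + (m \<bullet> u) * (l \<bullet> w) + 2 * ((a \<bullet> u) * (a \<bullet> w)) + 2 * ((b \<bullet> u) * (b \<bullet> w)))
      + 2 * s1 * ((a \<bullet> u) * (m \<bullet> w) + (m \<bullet> u) * (a \<bullet> w)) + 2 * s2 * ((b \<bullet> u) * (m \<bullet> w) + (m \<bullet> u) * (b \<bullet> w))
      + k * ((m \<bullet> u) * (m \<bullet> w) - (u \<bullet> w) / 3) = 0"
proof -
  define E where "E i j = \<sigma> * (l $ i * m $ j + m $ i * l $ j + 2 * (a $ i * a $ j) + 2 * (b $ i * b $ j))
      + 2 * s1 * (a $ i * m $ j + m $ i * a $ j) + 2 * s2 * (b $ i * m $ j + m $ i * b $ j)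
      + k * (m $ i * m $ j + (if i = j then - 1 / 3 else 0))" for i j
  have "(\<Sum>i\<in>UNIV. \<Sum>j\<in>UNIV. u $ i * w $ j * E i j) = 0"
    using assms by (simp add: E_def)
  then show ?thesis
    unfolding E_def sum_3 inner_vec_def inner_real_def by (simp add: algebra_simps)
qed

text \<open>The hypothesis is the \<open>(i, j)\<close> entry of the equilibrium equation in two variables for
  \<open>s (n \<otimes> n - I / 3)\<close>, with \<open>m = n\<close>, \<open>a\<close> and \<open>b\<close> the partial derivatives of \<open>n\<close>, \<open>l = \<Delta> n\<close>,
  \<open>\<sigma> = s\<close>, \<open>s1\<close> and \<open>s2\<close> the partial derivatives of \<open>s\<close>, and \<open>k = \<Delta> s - g(s) s\<close>.\<close>
lemma conformal_relations:
  fixes m l a b :: "real^3"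
  assumes E: "\<And>i j. \<sigma> * (l $ i * m $ j + m $ i * l $ j + 2 * (a $ i * a $ j) + 2 * (b $ i * b $ j))
      + 2 * s1 * (a $ i * m $ j + m $ i * a $ j) + 2 * s2 * (b $ i * m $ j + m $ i * b $ j)
      + k * (m $ i * m $ j + (if i = j then - 1 / 3 else 0)) = 0"
    and \<sigma>: "\<sigma> \<noteq> 0"
    and m: "m \<bullet> m = 1" "a \<bullet> m = 0" "b \<bullet> m = 0" "l \<bullet> m = - (a \<bullet> a + b \<bullet> b)"
  shows "a \<bullet> b = 0" "a \<bullet> a = b \<bullet> b" "k = 6 * \<sigma> * (a \<bullet> a)"
    "\<sigma> * (l \<bullet> a) + 2 * s1 * (a \<bullet> a) = 0" "\<sigma> * (l \<bullet> b) + 2 * s2 * (a \<bullet> a) = 0"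
proof -
  note C = quadratic_form_contract[OF E]
  have m': "m \<bullet> a = 0" "m \<bullet> b = 0" "b \<bullet> a = a \<bullet> b"
    using m by (simp_all add: inner_commute)
  define p q r where "p = a \<bullet> a" and "q = b \<bullet> b" and "r = a \<bullet> b"
  have pq: "p \<ge> 0" "q \<ge> 0" by (simp_all add: p_def q_def)
  \<comment> \<open>The contraction (m, m) determines k. Then (a, a) and (b, b) become quadratic
    relations for p, q, r once \<sigma> is cancelled, and (a, m), (b, m) give the tangential part of
    l.\<close>
  have k: "k = 3 * \<sigma> * (p + q)"
    using C[of m m] by (simp add: m m' p_def q_def algebra_simps)
  have "\<sigma> * (2 * (p * p) + 2 * (r * r)) = k * p / 3"
    using C[of a a] by (simp add: m m' p_def r_def algebra_simps)
  then have "\<sigma> * (2 * (p * p) + 2 * (r * r)) = \<sigma> * ((p + q) * p)" by (simp add: k)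
  then have 1: "p * p + 2 * (r * r) = p * q"
    unfolding mult_cancel_left using \<sigma> by (simp add: algebra_simps)
  have "\<sigma> * (2 * (r * r) + 2 * (q * q)) = k * q / 3"
    using C[of b b] by (simp add: m m' q_def r_def algebra_simps)
  then have "\<sigma> * (2 * (r * r) + 2 * (q * q)) = \<sigma> * ((p + q) * q)" by (simp add: k)
  then have 2: "q * q + 2 * (r * r) = p * q"
    unfolding mult_cancel_left using \<sigma> by (simp add: algebra_simps)
  \<comment> \<open>The difference of the two relations is free of r; once p = q, either of them
    leaves r^2 = 0.\<close>
  have "p^2 = q^2" using 1 2 by (simp add: power2_eq_square)
  then have pq': "p = q" using pq by (simp add: power2_eq_iff_nonneg)
  with 1 have r: "r = 0" by simp
  show "a \<bullet> b = 0" "a \<bullet> a = b \<bullet> b" "k = 6 * \<sigma> * (a \<bullet> a)"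
    using pq' r k by (simp_all add: p_def q_def r_def)
  have "\<sigma> * (l \<bullet> a) + 2 * s1 * p + 2 * s2 * r = 0"
    using C[of a m] by (simp add: m m' p_def r_def algebra_simps)
  then show "\<sigma> * (l \<bullet> a) + 2 * s1 * (a \<bullet> a) = 0" using r by (simp add: p_def)
  have "\<sigma> * (l \<bullet> b) + 2 * s1 * r + 2 * s2 * q = 0"
    using C[of b m] by (simp add: m m' q_def r_def algebra_simps)
  then show "\<sigma> * (l \<bullet> b) + 2 * s2 * (a \<bullet> a) = 0" using r pq' by (simp add: p_def q_def)
qed

text \<open>Otherwise v, m, a, b would be four nonzero pairwise orthogonal vectors in dimension
  three. It identifies second derivatives of n from their products with n and the two tangent
  vectors.\<close>

lemma orthogonal_triple_eq_0:
  fixes v m a b :: "real^3"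
  assumes "v \<bullet> m = 0" "v \<bullet> a = 0" "v \<bullet> b = 0" "m \<bullet> a = 0" "m \<bullet> b = 0" "a \<bullet> b = 0"
    and "m \<noteq> 0" "a \<noteq> 0" "b \<noteq> 0"
  shows "v = 0"
proof (rule ccontr)
  assume "v \<noteq> 0"
  have "pairwise orthogonal {v, m, a, b}"
    using assms by (auto simp: pairwise_def orthogonal_def inner_commute)
  then have "independent {v, m, a, b}"
    using assms \<open>v \<noteq> 0\<close> by (intro pairwise_orthogonal_independent) auto
  then have "card {v, m, a, b} \<le> 3"
    using independent_card_le[of "{v, m, a, b}"] by simp
  moreover have "v \<noteq> m" "v \<noteq> a" "v \<noteq> b" "m \<noteq> a" "m \<noteq> b" "a \<noteq> b"
    using assms \<open>v \<noteq> 0\<close> inner_eq_zero_iff by metis+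
  ultimately show False by simp
qed

lemma dirderiv_inner:
  fixes f g :: "'a::real_normed_vector \<Rightarrow> 'b::real_inner"
  assumes "smooth_on f V" "smooth_on g V" "x \<in> V"
  shows "dirderiv v (\<lambda>x. f x \<bullet> g x) x = f x \<bullet> dirderiv v g x + dirderiv v f x \<bullet> g x"
  by (rule dirderiv_bilinear[OF bounded_bilinear_inner assms])

text \<open>Source of the orthogonality relations below: unit length makes derivatives of n tangent,
  and differentiating tangency or constant metric coefficients gives components of second
  derivatives.\<close>

lemma dirderiv_inner_const:
  fixes f g :: "'a::real_normed_vector \<Rightarrow> 'b::real_inner"
  assumes "open V" "smooth_on f V" "smooth_on g V" "\<And>y. y \<in> V \<Longrightarrow> f y \<bullet> g y = c" "x \<in> V"
  shows "f x \<bullet> dirderiv v g x + dirderiv v f x \<bullet> g x = 0"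
proof -
  have "dirderiv v (\<lambda>x. f x \<bullet> g x) x = dirderiv v (\<lambda>x. c) x"
    by (rule dirderiv_cong[OF assms(1,5)]) (rule assms(4))
  then show ?thesis by (simp add: dirderiv_inner[OF assms(2,3,5)])
qed

text \<open>A case of Gauss's Theorema Egregium: the hypotheses force \<open>\<partial>\<^sub>w \<partial>\<^sub>v n = 0\<close> and \<open>\<partial>\<^sub>v \<partial>\<^sub>v n = - c n\<close>,
  so that the two ways of computing \<open>\<partial>\<^sub>w \<partial>\<^sub>v \<partial>\<^sub>v n\<close> disagree unless \<open>c = 0\<close>.\<close>
lemma no_flat_immersion_into_sphere:
  fixes n :: "'a::real_normed_vector \<Rightarrow> real^3"
  assumes V: "open V" "smooth_on n V" "x \<in> V"
    and unit: "\<And>y. y \<in> V \<Longrightarrow> n y \<bullet> n y = 1"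
    and iso: "\<And>y. y \<in> V \<Longrightarrow> dirderiv v n y \<bullet> dirderiv v n y = c"
      "\<And>y. y \<in> V \<Longrightarrow> dirderiv w n y \<bullet> dirderiv w n y = c"
      "\<And>y. y \<in> V \<Longrightarrow> dirderiv v n y \<bullet> dirderiv w n y = 0"
  shows "c = 0"
proof (rule ccontr)
  assume c: "c \<noteq> 0"
  note sv = smooth_on_dirderiv[OF V(2), of v] and sw = smooth_on_dirderiv[OF V(2), of w]
  have nv: "n y \<bullet> dirderiv v n y = 0" and nw: "n y \<bullet> dirderiv w n y = 0" if "y \<in> V" for y
    using dirderiv_inner_const[OF V(1,2,2) unit that] by (auto simp: inner_commute)
  have second: "dirderiv w (dirderiv v n) y = 0 \<and> dirderiv v (dirderiv v n) y = - c *\<^sub>R n y"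
    if y: "y \<in> V" for y
  proof -
    have comm: "dirderiv v (dirderiv w n) y = dirderiv w (dirderiv v n) y"
      by (rule dirderiv_commute[OF V(1,2) y])
    \<comment> \<open>The metric coefficients are constant, so the Christoffel symbols vanish: these
      second derivatives have no tangential part. Their normal parts come from differentiating
      tangency.\<close>
    have a: "dirderiv v (dirderiv v n) y \<bullet> dirderiv v n y = 0"
      and b: "dirderiv w (dirderiv v n) y \<bullet> dirderiv v n y = 0"
      and c': "dirderiv w (dirderiv v n) y \<bullet> dirderiv w n y = 0"
      using dirderiv_inner_const[OF V(1) sv sv iso(1) y, of v] dirderiv_inner_const[OF V(1) sv sv iso(1) y, of w]
        dirderiv_inner_const[OF V(1) sw sw iso(2) y, of v]
      by (auto simp: inner_commute comm)
    have d: "dirderiv v (dirderiv v n) y \<bullet> dirderiv w n y = 0"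
      using dirderiv_inner_const[OF V(1) sv sw iso(3) y, of v] b by (simp add: comm inner_commute)
    have e: "dirderiv w (dirderiv v n) y \<bullet> n y = 0"
      using dirderiv_inner_const[OF V(1,2) sv nv y, of w] iso(3)[OF y] by (simp add: inner_commute)
    have f: "dirderiv v (dirderiv v n) y \<bullet> n y = - c"
      using dirderiv_inner_const[OF V(1,2) sv nv y, of v] iso(1)[OF y] by (simp add: inner_commute)
    have ne: "n y \<noteq> 0" "dirderiv v n y \<noteq> 0" "dirderiv w n y \<noteq> 0"
      using unit[OF y] iso(1,2)[OF y] c by auto
    have "dirderiv w (dirderiv v n) y = 0"
      by (rule orthogonal_triple_eq_0[OF e b c' nv[OF y] nw[OF y] iso(3)[OF y] ne])
    moreover have "dirderiv v (dirderiv v n) y + c *\<^sub>R n y = 0"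
      by (rule orthogonal_triple_eq_0[OF _ _ _ nv[OF y] nw[OF y] iso(3)[OF y] ne])
        (simp_all add: inner_add_left a d f unit[OF y] nv[OF y] nw[OF y])
    ultimately show ?thesis by (simp add: eq_neg_iff_add_eq_0)
  qed
  have "dirderiv w (dirderiv v (dirderiv v n)) x = dirderiv v (dirderiv w (dirderiv v n)) x"
    by (rule dirderiv_commute[OF V(1) sv V(3)])
  also have "\<dots> = dirderiv v (\<lambda>x. 0) x"
    by (rule dirderiv_cong[OF V(1,3)]) (use second in blast)
  also have "\<dots> = 0" by simp
  finally have "dirderiv w (dirderiv v (dirderiv v n)) x = 0" .
  moreover have "dirderiv w (dirderiv v (dirderiv v n)) x = dirderiv w (\<lambda>x. - c *\<^sub>R n x) x"
    by (rule dirderiv_cong[OF V(1,3)]) (use second in blast)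
  moreover have "\<dots> = - c *\<^sub>R dirderiv w n x"
    by (rule dirderiv_bounded_linear[OF bounded_linear_scaleR_right V(2,3)])
  ultimately have "dirderiv w n x = 0" using c by simp
  then show False using iso(2)[OF V(3)] c by simp
qed

section \<open>Local constancy of the director\<close>

lemma sum_frame:
  fixes e :: "3 \<Rightarrow> real^3"
  assumes "\<And>v. v = (\<Sum>j\<in>UNIV. (v \<bullet> e j) *\<^sub>R e j)" "linear h" "\<And>j. h (e j) = 0"
  shows "h v = 0"
proof -
  have "h v = (\<Sum>j\<in>UNIV. (v \<bullet> e j) *\<^sub>R h (e j))"
    by (subst assms(1)) (simp add: linear_sum[OF assms(2)] linear_scale[OF assms(2)])
  then show ?thesis by (simp add: assms(3))
qed

lemma smooth_constant_on_ball:
  fixes f :: "'a::real_normed_vector \<Rightarrow> 'b::real_normed_vector"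
  assumes "smooth_on f (ball z d)" "\<And>v y. y \<in> ball z d \<Longrightarrow> dirderiv v f y = 0" "y \<in> ball z d"
  shows "f y = f z"
proof -
  have "(f has_derivative (\<lambda>v. 0)) (at y within ball z d)" if "y \<in> ball z d" for y
    using smooth_on_has_derivative[OF assms(1) that] assms(2)[OF that]
    by (simp add: has_derivative_at_withinI)
  then obtain c where "\<And>y. y \<in> ball z d \<Longrightarrow> f y = c"
    using has_derivative_zero_constant[OF convex_ball] by blast
  moreover have "z \<in> ball z d" using assms(3) by (metis centre_in_ball ball_empty empty_iff not_le)
  ultimately show ?thesis using assms(3) by metis
qed

text \<open>The frame is adapted to the invariance: nothing changes along \<open>e 1\<close>, and
  \<open>e 2\<close>, \<open>e 3\<close> are the two coordinate directions of a planar
  problem.\<close>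

lemma director_locally_constant:
  fixes s :: "real^3 \<Rightarrow> real" and n :: "real^3 \<Rightarrow> real^3" and e :: "3 \<Rightarrow> real^3"
  assumes V: "open V" and sm: "smooth_on s V" "smooth_on n V"
    and unit: "\<And>x. x \<in> V \<Longrightarrow> n x \<bullet> n x = 1"
    and s: "\<And>x. x \<in> V \<Longrightarrow> s x \<noteq> 0"
    and frame: "\<And>v. v = (\<Sum>j\<in>UNIV. (v \<bullet> e j) *\<^sub>R e j)"
    and inv: "\<And>x. x \<in> V \<Longrightarrow> dirderiv (e 1) s x = 0" "\<And>x. x \<in> V \<Longrightarrow> dirderiv (e 1) n x = 0"
    and eq: "\<And>x i j. x \<in> V \<Longrightarrow> (\<Sum>k\<in>{2, 3}. dirderiv (e k) (dirderiv (e k)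
        (\<lambda>x. s x * (n x $ i * n x $ j + (if i = j then - 1 / 3 else 0)))) x)
      = g (s x) * (s x * (n x $ i * n x $ j + (if i = j then - 1 / 3 else 0)))"
    and x: "x \<in> V"
  shows "dirderiv v n x = 0"
proof -
  define a b where "a = dirderiv (e 2) n" and "b = dirderiv (e 3) n"
  define l where "l x = dirderiv (e 2) a x + dirderiv (e 3) b x" for x
  define k where "k x = dirderiv (e 2) (dirderiv (e 2) s) x + dirderiv (e 3) (dirderiv (e 3) s) x - g (s x) * s x" for x
  have sa: "smooth_on a V" and sb: "smooth_on b V"
    unfolding a_def b_def by (rule smooth_on_dirderiv[OF sm(2)])+
  have na: "n x \<bullet> a x = 0" and nb: "n x \<bullet> b x = 0" if "x \<in> V" for x
    using dirderiv_inner_const[OF V sm(2,2) unit that] by (auto simp: inner_commute a_def b_def)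
  have conf: "a x \<bullet> b x = 0" "a x \<bullet> a x = b x \<bullet> b x" "k x = 6 * s x * (a x \<bullet> a x)"
    "s x * (l x \<bullet> a x) + 2 * dirderiv (e 2) s x * (a x \<bullet> a x) = 0"
    "s x * (l x \<bullet> b x) + 2 * dirderiv (e 3) s x * (a x \<bullet> a x) = 0" if "x \<in> V" for x
  proof -
    have E: "s x * (l x $ i * n x $ j + n x $ i * l x $ j + 2 * (a x $ i * a x $ j) + 2 * (b x $ i * b x $ j))
      + 2 * dirderiv (e 2) s x * (a x $ i * n x $ j + n x $ i * a x $ j)
      + 2 * dirderiv (e 3) s x * (b x $ i * n x $ j + n x $ i * b x $ j)
      + k x * (n x $ i * n x $ j + (if i = j then - 1 / 3 else 0)) = 0" for i j
      using eq[OF that, of i j] unfolding entry_dirderiv2[OF V sm that]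
      by (simp add: l_def k_def a_def b_def algebra_simps split del: if_split)
    have perp: "a x \<bullet> n x = 0" "b x \<bullet> n x = 0"
      using na nb that by (simp_all add: inner_commute)
    \<comment> \<open>Differentiate n . a = 0 along \<open>e 2\<close> and n . b = 0 along
      \<open>e 3\<close>, and add.\<close>
    have "l x \<bullet> n x = - (a x \<bullet> a x + b x \<bullet> b x)"
      using dirderiv_inner_const[OF V sm(2) sa na that, of "e 2"] dirderiv_inner_const[OF V sm(2) sb nb that, of "e 3"]
      by (simp add: l_def a_def b_def inner_add_left inner_add_right inner_commute)
    note R = conformal_relations[OF E s[OF that] unit[OF that] perp this]
    show "a x \<bullet> b x = 0" "a x \<bullet> a x = b x \<bullet> b x" "k x = 6 * s x * (a x \<bullet> a x)"
      "s x * (l x \<bullet> a x) + 2 * dirderiv (e 2) s x * (a x \<bullet> a x) = 0"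
      "s x * (l x \<bullet> b x) + 2 * dirderiv (e 3) s x * (a x \<bullet> a x) = 0"
      by (rule R)+
  qed
  \<comment> \<open>A conformal map in two variables is harmonic: \<open>\<Delta> n\<close> is normal to the sphere.\<close>
  have harmonic: "l x \<bullet> a x = 0 \<and> l x \<bullet> b x = 0" if x: "x \<in> V" for x
  proof -
    have comm: "dirderiv (e 3) a x = dirderiv (e 2) b x"
      unfolding a_def b_def by (rule dirderiv_commute[OF V sm(2) x])
    have "dirderiv v (\<lambda>x. a x \<bullet> a x) x = dirderiv v (\<lambda>x. b x \<bullet> b x) x" for v
      by (rule dirderiv_cong[OF V x]) (rule conf(2))
    then have pq: "a x \<bullet> dirderiv v a x = b x \<bullet> dirderiv v b x" for v
      by (simp add: dirderiv_inner[OF sa sa x] dirderiv_inner[OF sb sb x] inner_commute)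
    have r: "a x \<bullet> dirderiv v b x + dirderiv v a x \<bullet> b x = 0" for v
      by (rule dirderiv_inner_const[OF V sa sb conf(1) x])
    \<comment> \<open>With d2, d3 the derivatives along \<open>e 2\<close>, \<open>e 3\<close>: d2 a
      . a = d2 b . b = d3 a . b = - a . d3 b, so l . a = 0. The product with b is symmetric.\<close>
    show ?thesis
      using pq[of "e 2"] pq[of "e 3"] r[of "e 2"] r[of "e 3"]
      by (simp add: l_def inner_add_left inner_add_right inner_commute comm)
  qed
  have "a x \<bullet> a x = 0" if x: "x \<in> V" for x
  proof (rule ccontr)
    assume "a x \<bullet> a x \<noteq> 0"
    let ?W = "V \<inter> (\<lambda>y. a y \<bullet> a y) -` (- {0})"
    have "open ?W"
      using smooth_on_imp_continuous_on[OF sa]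
      by (intro continuous_open_preimage continuous_on_inner V) auto
    moreover have "x \<in> ?W" using x \<open>a x \<bullet> a x \<noteq> 0\<close> by simp
    ultimately obtain d where d: "d > 0" "ball x d \<subseteq> ?W"
      by (rule openE)
    then have B: "y \<in> V" "a y \<bullet> a y \<noteq> 0" if "y \<in> ball x d" for y
      using that by auto
    have BV: "ball x d \<subseteq> V" using B by blast
    have Ds: "dirderiv v s y = 0" if y: "y \<in> ball x d" for v y
    proof (rule sum_frame[OF frame linear_dirderiv[OF sm(1) B(1)[OF y]]])
      have "dirderiv (e 2) s y = 0" "dirderiv (e 3) s y = 0"
        using conf(4,5)[OF B(1)[OF y]] harmonic[OF B(1)[OF y]] B(2)[OF y] by auto
      then show "dirderiv (e j) s y = 0" for j
        using inv(1)[OF B(1)[OF y]] exhaust_3[of j] by auto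
    qed
    have DDs: "dirderiv w (dirderiv v s) y = 0" if y: "y \<in> ball x d" for v w y
    proof -
      have "dirderiv w (dirderiv v s) y = dirderiv w (\<lambda>y. 0) y"
        by (rule dirderiv_cong[OF open_ball y]) (rule Ds)
      then show ?thesis by simp
    qed
    \<comment> \<open>As s is constant here, its Laplacian drops out of \<open>k\<close>; what
      remains is compared with k = 6 s |a|^2.\<close>
    have p: "a y \<bullet> a y = - g (s x) / 6" if y: "y \<in> ball x d" for y
    proof -
      have sy: "s y = s x"
        by (rule smooth_constant_on_ball[OF smooth_on_subset[OF sm(1) BV] Ds y])
      have "- g (s x) * s x = 6 * s x * (a y \<bullet> a y)"
        using conf(3)[OF B(1)[OF y]] by (simp add: k_def DDs[OF y] sy)
      then have "s x * (g (s x) + 6 * (a y \<bullet> a y)) = 0"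
        by (simp add: algebra_simps)
      then show ?thesis using s[OF x] by simp
    qed
    have "- g (s x) / 6 = 0"
    proof (rule no_flat_immersion_into_sphere[OF open_ball smooth_on_subset[OF sm(2) BV], of x "e 2" _ "e 3"])
      show "x \<in> ball x d" using d by simp
    qed (use unit conf(1,2) B p in \<open>auto simp: a_def b_def\<close>)
    then show False using p[of x] \<open>a x \<bullet> a x \<noteq> 0\<close> d by simp
  qed
  then have "a x = 0" "b x = 0" using conf(2)[OF x] x by simp_all
  then have "dirderiv (e j) n x = 0" for j
    using inv(2)[OF x] exhaust_3[of j] by (auto simp: a_def b_def)
  then show ?thesis
    by (rule sum_frame[OF frame linear_dirderiv[OF sm(2) x]])
qed

section \<open>Uniaxial tensors\<close>

lemma uniaxial_tensor_nth:
  "uniaxial_tensor \<sigma> n $ i $ j = \<sigma> * (n $ i * n $ j + (if i = j then - 1 / 3 else 0))"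
  by (simp add: uniaxial_tensor_def outer_def mat_def)

text \<open>The eigenvalues are 2 \<sigma> / 3 along n and - \<sigma> / 3 twice across it; this is
  (Q - 2 \<sigma> / 3 I) (Q + \<sigma> / 3 I) = 0 expanded.\<close>

lemma uniaxial_tensor_square:
  assumes "n \<bullet> n = 1"
  shows "uniaxial_tensor \<sigma> n ** uniaxial_tensor \<sigma> n
    = (\<sigma> / 3) *\<^sub>R uniaxial_tensor \<sigma> n + (2 / 9 * \<sigma>\<^sup>2) *\<^sub>R mat 1"
proof -
  have n: "n $ 1 * n $ 1 + n $ 2 * n $ 2 + n $ 3 * n $ 3 = 1"
    using assms by (simp add: inner_vec_def sum_3)
  \<comment> \<open>|n|^2 is left as a sum of three squares so that \<open>n\<close> can rewrite it
    to 1 afterwards.\<close>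
  have step: "(\<Sum>k\<in>UNIV. (n $ i * n $ k + (if i = k then - 1 / 3 else 0)) * (n $ k * n $ j + (if k = j then - 1 / 3 else 0)))
      = n $ i * n $ j * (n $ 1 * n $ 1 + n $ 2 * n $ 2 + n $ 3 * n $ 3) - 2 / 3 * (n $ i * n $ j)
        + (if i = j then 1 / 9 else 0)" for i j
    using exhaust_3[of i] exhaust_3[of j] by (auto simp: sum_3 algebra_simps)
  have *: "(\<Sum>k\<in>UNIV. (n $ i * n $ k + (if i = k then - 1 / 3 else 0)) * (n $ k * n $ j + (if k = j then - 1 / 3 else 0)))
      = 1 / 3 * (n $ i * n $ j + (if i = j then - 1 / 3 else 0)) + (if i = j then 2 / 9 else 0)" for i j
    unfolding step n by (cases "i = j") (simp_all add: field_simps)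
  have "(\<Sum>k\<in>UNIV. uniaxial_tensor \<sigma> n $ i $ k * uniaxial_tensor \<sigma> n $ k $ j)
      = \<sigma>\<^sup>2 * (\<Sum>k\<in>UNIV. (n $ i * n $ k + (if i = k then - 1 / 3 else 0)) * (n $ k * n $ j + (if k = j then - 1 / 3 else 0)))" for i j
    unfolding uniaxial_tensor_nth sum_distrib_left by (rule sum.cong) (simp_all add: power2_eq_square)
  then show ?thesis
    unfolding * by (simp add: vec_eq_iff matrix_matrix_mult_def uniaxial_tensor_nth mat_def power2_eq_square algebra_simps)
qed

lemma trace_uniaxial_tensor:
  assumes "n \<bullet> n = 1"
  shows "trace (uniaxial_tensor \<sigma> n) = 0"
proof -
  have "n $ 1 * n $ 1 + n $ 2 * n $ 2 + n $ 3 * n $ 3 = 1"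
    using assms by (simp add: inner_vec_def sum_3)
  then have "\<sigma> * (n $ 1 * n $ 1 + n $ 2 * n $ 2 + n $ 3 * n $ 3) = \<sigma>" by simp
  then show ?thesis
    by (simp add: trace_def uniaxial_tensor_nth sum_3 algebra_simps)
qed

lemma linear_trace: "linear (trace :: real^'n^'n \<Rightarrow> real)"
  by (rule linearI) (simp_all add: trace_def sum.distrib sum_distrib_left)

lemma bilinear_matrix_matrix_mult: "bilinear ((**) :: real^'n^'m \<Rightarrow> real^'p^'n \<Rightarrow> real^'p^'m)"
  unfolding bilinear_def
  by (intro conjI allI linearI)
    (simp_all add: matrix_matrix_mult_def vec_eq_iff sum.distrib sum_distrib_left algebra_simps)

lemma bounded_linear_trace: "bounded_linear (trace :: real^'n^'n \<Rightarrow> real)"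
  using linear_trace linear_conv_bounded_linear by blast

lemma bounded_bilinear_matrix_matrix_mult:
  "bounded_bilinear ((**) :: real^'n^'m \<Rightarrow> real^'p^'n \<Rightarrow> real^'p^'m)"
  using bilinear_matrix_matrix_mult bilinear_conv_bounded_bilinear by blast

lemma bounded_linear_matrix_vector_mult_left: "bounded_linear (\<lambda>A :: real^'n^'m. A *v v)"
proof -
  have "linear (\<lambda>A :: real^'n^'m. A *v v)"
    by (rule linearI)
      (simp_all add: matrix_vector_mult_def vec_eq_iff sum.distrib sum_distrib_left algebra_simps)
  then show ?thesis using linear_conv_bounded_linear by blast
qed

lemma trace_scaleR_mat: "trace (c *\<^sub>R mat 1 :: real^3^3) = 3 * c"
  by (simp add: trace_def mat_def sum_3)

lemma trace_square_uniaxial_tensor: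
  assumes "n \<bullet> n = 1"
  shows "trace (uniaxial_tensor \<sigma> n ** uniaxial_tensor \<sigma> n) = 2 / 3 * \<sigma>\<^sup>2"
  unfolding uniaxial_tensor_square[OF assms] linear_add[OF linear_trace] linear_scale[OF linear_trace]
    trace_uniaxial_tensor[OF assms]
  using trace_scaleR_mat[of 1] by simp

text \<open>Multiply the quadratic relation by Q and take traces.\<close>

lemma trace_cube_uniaxial_tensor:
  assumes "n \<bullet> n = 1"
  shows "trace (uniaxial_tensor \<sigma> n ** uniaxial_tensor \<sigma> n ** uniaxial_tensor \<sigma> n) = 2 / 9 * \<sigma> ^ 3"
proof -
  let ?Q = "uniaxial_tensor \<sigma> n"
  interpret bounded_bilinear "(**) :: real^3^3 \<Rightarrow> real^3^3 \<Rightarrow> real^3^3"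
    by (rule bounded_bilinear_matrix_matrix_mult)
  have "?Q ** ?Q ** ?Q = (\<sigma> / 3) *\<^sub>R (?Q ** ?Q) + (2 / 9 * \<sigma>\<^sup>2) *\<^sub>R ?Q"
    by (subst (1) uniaxial_tensor_square[OF assms]) (simp only: add_left scaleR_left matrix_mul_lid)
  then show ?thesis
    by (simp add: linear_add[OF linear_trace] linear_scale[OF linear_trace]
      trace_uniaxial_tensor[OF assms] trace_square_uniaxial_tensor[OF assms] power2_eq_square power3_eq_cube)
qed

lemma uniaxial_tensor_mult_vec:
  "uniaxial_tensor \<sigma> m *v v = \<sigma> *\<^sub>R ((m \<bullet> v) *\<^sub>R m - (1 / 3) *\<^sub>R v)"
  by (auto simp: vec_eq_iff matrix_vector_mult_def uniaxial_tensor_nth inner_vec_def sum_3 forall_3 algebra_simps)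

lemma uniaxial_tensor_minus: "uniaxial_tensor \<sigma> (- m) = uniaxial_tensor \<sigma> m"
  by (simp add: vec_eq_iff uniaxial_tensor_nth)

lemma uniaxial_tensor_eq_0_iff:
  assumes "n \<bullet> n = 1"
  shows "uniaxial_tensor \<sigma> n = 0 \<longleftrightarrow> \<sigma> = 0"
proof
  assume *: "uniaxial_tensor \<sigma> n = 0"
  have "2 / 3 * \<sigma>\<^sup>2 = 0"
    using trace_square_uniaxial_tensor[OF assms, of \<sigma>] by (simp add: * trace_def)
  then show "\<sigma> = 0" by simp
qed (simp add: uniaxial_tensor_def)

section \<open>Orthonormal frames and the Laplacian\<close>

text \<open>The image of the standard basis under an orthogonal map taking \<open>axis k 1\<close>
  to \<nu>. The expansion of every vector is the form in which orthonormality is used below.\<close>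

lemma orthonormal_frame:
  fixes \<nu> :: "real^'n"
  assumes "norm \<nu> = 1"
  obtains e :: "'n \<Rightarrow> real^'n" where "e k = \<nu>" "\<And>v. v = (\<Sum>j\<in>UNIV. (v \<bullet> e j) *\<^sub>R e j)"
proof -
  obtain f :: "real^'n \<Rightarrow> real^'n" where f: "orthogonal_transformation f" "f (axis k 1) = \<nu>"
    using orthogonal_transformation_exists_1[OF norm_axis_1[of k] assms] by blast
  define e where "e j = f (axis j 1)" for j
  note lin = orthogonal_transformation_linear[OF f(1)]
  have "v = (\<Sum>j\<in>UNIV. (v \<bullet> e j) *\<^sub>R e j)" for v
  proof -
    obtain u where u: "v = f u"
      using orthogonal_transformation_surj[OF f(1)] by (metis surjD)
    have "u = (\<Sum>j\<in>UNIV. (u $ j) *\<^sub>R axis j 1)"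
      by (simp add: vec_eq_iff axis_def if_distrib sum.delta cong: if_cong)
    then have "f u = (\<Sum>j\<in>UNIV. (u $ j) *\<^sub>R f (axis j 1))"
      by (metis (no_types, lifting) linear_sum[OF lin] linear_scale[OF lin] sum.cong)
    moreover have "f u \<bullet> e j = u $ j" for j
      using f(1) by (simp add: e_def orthogonal_transformation_def inner_axis)
    ultimately show ?thesis by (simp add: u e_def)
  qed
  then show ?thesis using that[of e] f(2) by (simp add: e_def)
qed

text \<open>Basis independence of the trace: expand the first argument in the frame, exchange the
  sums, and reassemble the second argument from its standard coordinates.\<close>

lemma bilinear_trace_frame:
  fixes e :: "'n \<Rightarrow> real^'n" and B :: "real^'n \<Rightarrow> real^'n \<Rightarrow> 'b::real_vector"
  assumes "\<And>v. v = (\<Sum>j\<in>UNIV. (v \<bullet> e j) *\<^sub>R e j)"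
    and "\<And>w. linear (\<lambda>v. B v w)" "\<And>v. linear (B v)"
  shows "(\<Sum>k\<in>UNIV. B (axis k 1) (axis k 1)) = (\<Sum>j\<in>UNIV. B (e j) (e j))"
proof -
  have inner: "(\<Sum>k\<in>UNIV. (e j $ k) *\<^sub>R B (e j) (axis k 1)) = B (e j) (e j)" for j
  proof -
    have "e j = (\<Sum>k\<in>UNIV. (e j $ k) *\<^sub>R axis k 1)"
      by (simp add: vec_eq_iff axis_def if_distrib sum.delta cong: if_cong)
    then have "B (e j) (e j) = B (e j) (\<Sum>k\<in>UNIV. (e j $ k) *\<^sub>R axis k 1)"
      by (rule arg_cong)
    then show ?thesis
      by (simp add: linear_sum[OF assms(3)] linear_scale[OF assms(3)])
  qed
  have "B (axis k 1) (axis k 1) = (\<Sum>j\<in>UNIV. (e j $ k) *\<^sub>R B (e j) (axis k 1))" for k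
  proof -
    have "B (axis k 1) (axis k 1) = B (\<Sum>j\<in>UNIV. (axis k 1 \<bullet> e j) *\<^sub>R e j) (axis k 1)"
      by (rule arg_cong[OF assms(1), of "\<lambda>v. B v (axis k 1)"])
    also have "\<dots> = (\<Sum>j\<in>UNIV. (axis k 1 \<bullet> e j) *\<^sub>R B (e j) (axis k 1))"
      by (simp add: linear_sum[OF assms(2)] linear_scale[OF assms(2)])
    finally show ?thesis by (simp add: inner_axis')
  qed
  then have "(\<Sum>k\<in>UNIV. B (axis k 1) (axis k 1)) = (\<Sum>k\<in>UNIV. \<Sum>j\<in>UNIV. (e j $ k) *\<^sub>R B (e j) (axis k 1))"
    by (rule sum.cong[OF refl])
  also have "\<dots> = (\<Sum>j\<in>UNIV. \<Sum>k\<in>UNIV. (e j $ k) *\<^sub>R B (e j) (axis k 1))"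
    by (rule sum.swap)
  also have "\<dots> = (\<Sum>j\<in>UNIV. B (e j) (e j))"
    by (intro sum.cong refl inner)
  finally show ?thesis .
qed

text \<open>Linearity in the inner direction holds throughout the open set S and can therefore be
  differentiated. With linearity in the outer direction it makes the Hessian bilinear.\<close>

lemma linear_dirderiv_inner:
  assumes "open S" "smooth_on f S" "x \<in> S"
  shows "linear (\<lambda>v. dirderiv w (dirderiv v f) x)"
proof (rule linearI)
  note sm = smooth_on_dirderiv[OF assms(2)]
  fix u v :: 'a and c :: real
  have "dirderiv w (dirderiv (u + v) f) x = dirderiv w (\<lambda>y. dirderiv u f y + dirderiv v f y) x"
    by (rule dirderiv_cong[OF assms(1,3)]) (rule linear_add[OF linear_dirderiv[OF assms(2)]])
  then show "dirderiv w (dirderiv (u + v) f) x = dirderiv w (dirderiv u f) x + dirderiv w (dirderiv v f) x"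
    by (simp only: dirderiv_add[OF sm sm assms(3)])
  have "dirderiv w (dirderiv (c *\<^sub>R v) f) x = dirderiv w (\<lambda>y. c *\<^sub>R dirderiv v f y) x"
    by (rule dirderiv_cong[OF assms(1,3)]) (rule linear_scale[OF linear_dirderiv[OF assms(2)]])
  then show "dirderiv w (dirderiv (c *\<^sub>R v) f) x = c *\<^sub>R dirderiv w (dirderiv v f) x"
    by (simp only: dirderiv_bounded_linear[OF bounded_linear_scaleR_right sm assms(3)])
qed

lemma laplacian_frame:
  fixes e :: "'n::finite \<Rightarrow> real^'n"
  assumes "\<And>v. v = (\<Sum>j\<in>UNIV. (v \<bullet> e j) *\<^sub>R e j)" "open S" "smooth_on f S" "x \<in> S"
  shows "laplacian f x = (\<Sum>j\<in>UNIV. dirderiv (e j) (dirderiv (e j) f) x)"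
proof -
  have pd: "partial_deriv k g = dirderiv (axis k 1) g" for k and g :: "real^'n \<Rightarrow> real"
    by (simp add: partial_deriv_def dirderiv_def fun_eq_iff)
  show ?thesis
    unfolding laplacian_def pd
    by (rule bilinear_trace_frame[OF assms(1), where B = "\<lambda>v w. dirderiv w (dirderiv v f) x"])
      (rule linear_dirderiv_inner[OF assms(2-4)] linear_dirderiv[OF smooth_on_dirderiv[OF assms(3)] assms(4)])+
qed

section \<open>The equation in terms of s and n\<close>

lemma uniaxial_equilibrium:
  assumes "equilibrium_eq L \<phi> Q \<Omega>" "L \<noteq> 0"
  obtains g :: "real \<Rightarrow> real" where
    "\<And>x \<sigma> n. x \<in> \<Omega> \<Longrightarrow> n \<bullet> n = 1 \<Longrightarrow> Q x = uniaxial_tensor \<sigma> n \<Longrightarrow> tensor_laplacian Q x = g \<sigma> *\<^sub>R Q x"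
proof -
  define \<phi>1 where "\<phi>1 \<sigma> = deriv (\<lambda>a. \<phi> a (2 / 9 * \<sigma> ^ 3)) (2 / 3 * \<sigma>\<^sup>2)" for \<sigma>
  define \<phi>2 where "\<phi>2 \<sigma> = deriv (\<lambda>b. \<phi> (2 / 3 * \<sigma>\<^sup>2) b) (2 / 9 * \<sigma> ^ 3)" for \<sigma>
  \<comment> \<open>The summand \<open>\<phi>2 \<sigma> * \<sigma>\<close> is 3 \<phi>2 times the
    factor \<sigma> / 3 by which the trace-free part of Q^2 is a multiple of Q.\<close>
  define g where "g \<sigma> = (2 * \<phi>1 \<sigma> + \<phi>2 \<sigma> * \<sigma>) / L" for \<sigma>
  show ?thesis
  proof (rule that[of g])
    fix x \<sigma> n assume x: "x \<in> \<Omega>" and n: "n \<bullet> n = 1" and Q: "Q x = uniaxial_tensor \<sigma> n"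
    have tr: "trace (Q x ** Q x) = 2 / 3 * \<sigma>\<^sup>2" "trace (Q x ** Q x ** Q x) = 2 / 9 * \<sigma> ^ 3"
      using trace_square_uniaxial_tensor[OF n] trace_cube_uniaxial_tensor[OF n] Q by simp_all
    have "L *\<^sub>R tensor_laplacian Q x = (2 * \<phi>1 \<sigma>) *\<^sub>R Q x
        + (3 * \<phi>2 \<sigma>) *\<^sub>R (Q x ** Q x - (tensor_norm_sq (Q x) / 3) *\<^sub>R mat 1)"
      using assms(1) x unfolding equilibrium_eq_def Let_def \<phi>1_def \<phi>2_def tr[symmetric] by blast
    also have "Q x ** Q x - (tensor_norm_sq (Q x) / 3) *\<^sub>R mat 1 = (\<sigma> / 3) *\<^sub>R Q x"
      unfolding tensor_norm_sq_def tr unfolding Q uniaxial_tensor_square[OF n] by simp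
    also have "(2 * \<phi>1 \<sigma>) *\<^sub>R Q x + (3 * \<phi>2 \<sigma>) *\<^sub>R (\<sigma> / 3) *\<^sub>R Q x = L *\<^sub>R (g \<sigma> *\<^sub>R Q x)"
      using assms(2) by (simp add: g_def scaleR_add_left[symmetric])
    finally show "tensor_laplacian Q x = g \<sigma> *\<^sub>R Q x"
      unfolding scaleR_cancel_left using assms(2) by simp
  qed
qed

text \<open>For \<open>Q = s (n \<otimes> n - I / 3)\<close> one recovers \<open>s = 3 tr Q\<^sup>3 / tr Q\<^sup>2\<close> and \<open>n \<otimes> n = Q / s + I / 3\<close>; applying the
  latter to the director at \<open>x0\<close> and normalising selects a smooth sign for \<open>n\<close>.\<close>
lemma smooth_director:
  fixes Q :: "'a::real_normed_vector \<Rightarrow> real^3^3"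
  assumes "open U" "smooth_on Q U" "\<And>x. x \<in> U \<Longrightarrow> Q x \<in> uniaxial" "\<And>x. x \<in> U \<Longrightarrow> Q x \<noteq> 0" "x0 \<in> U"
  obtains V s n where "open V" "x0 \<in> V" "V \<subseteq> U" "smooth_on s V" "smooth_on n V"
    "\<forall>x\<in>V. n x \<bullet> n x = 1 \<and> s x \<noteq> 0 \<and> Q x = uniaxial_tensor (s x) (n x)"
proof -
  have rep: "\<exists>\<sigma> m. m \<bullet> m = 1 \<and> \<sigma> \<noteq> 0 \<and> Q x = uniaxial_tensor \<sigma> m" if x: "x \<in> U" for x
  proof -
    obtain \<sigma> m where Q: "Q x = uniaxial_tensor \<sigma> m" and "norm m = 1"
      using assms(3)[OF x] by (auto simp: uniaxial_def)
    then have m: "m \<bullet> m = 1" by (simp add: dot_square_norm)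
    then show ?thesis using uniaxial_tensor_eq_0_iff[OF m] assms(4)[OF x] Q by metis
  qed
  define s where "s x = 3 * (trace (Q x ** Q x ** Q x) * inverse (trace (Q x ** Q x)))" for x
  have s_eq: "s x = \<sigma>" if "Q x = uniaxial_tensor \<sigma> m" "m \<bullet> m = 1" for x \<sigma> m
    unfolding s_def that(1) trace_square_uniaxial_tensor[OF that(2)] trace_cube_uniaxial_tensor[OF that(2)]
    by (cases "\<sigma> = 0") (simp_all add: power2_eq_square power3_eq_cube)
  note QQ = smooth_on_bilinear[OF bounded_bilinear_matrix_matrix_mult assms(1,2,2)]
  note QQQ = smooth_on_bilinear[OF bounded_bilinear_matrix_matrix_mult assms(1) QQ assms(2)]
  have tr0: "trace (Q x ** Q x) \<noteq> 0" if "x \<in> U" for x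
  proof -
    obtain \<sigma> m where "m \<bullet> m = 1" "\<sigma> \<noteq> 0" "Q x = uniaxial_tensor \<sigma> m"
      using rep[OF \<open>x \<in> U\<close>] by blast
    then show ?thesis by (simp add: trace_square_uniaxial_tensor)
  qed
  have sm_s: "smooth_on s U"
    unfolding s_def
    by (intro smooth_on_mult[OF assms(1)] smooth_on_const smooth_on_inverse[OF assms(1)]
      smooth_on_bounded_linear[OF bounded_linear_trace assms(1)] QQ QQQ tr0)
  have s0: "s x \<noteq> 0" if "x \<in> U" for x
    using rep[OF that] s_eq by metis
  obtain \<sigma>0 n0 where n0: "n0 \<bullet> n0 = 1" "Q x0 = uniaxial_tensor \<sigma>0 n0"
    using rep[OF assms(5)] by blast
  \<comment> \<open>p x is n n^T applied to n0, with n a director at x; it is insensitive to the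
    sign of n.\<close>
  define p where "p x = inverse (s x) *\<^sub>R (Q x *v n0) + (1 / 3) *\<^sub>R n0" for x
  have p: "p x = (m \<bullet> n0) *\<^sub>R m" if "x \<in> U" "Q x = uniaxial_tensor \<sigma> m" "m \<bullet> m = 1" for x \<sigma> m
    using s_eq[OF that(2,3)] s0[OF that(1)]
    by (simp add: p_def that(2) uniaxial_tensor_mult_vec)
  have sm_p: "smooth_on p U"
    unfolding p_def
    by (intro smooth_on_add[OF assms(1)] smooth_on_const smooth_on_scaleR[OF assms(1)]
      smooth_on_inverse[OF assms(1)] smooth_on_bounded_linear[OF bounded_linear_matrix_vector_mult_left assms(1)]
      sm_s s0 assms(2))
  define q where "q x = p x \<bullet> n0" for x
  have sm_q: "smooth_on q U"
    unfolding q_def by (intro smooth_on_bilinear[OF bounded_bilinear_inner assms(1)] sm_p smooth_on_const)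
  \<comment> \<open>q x is the square of m . n0 for a director m at x. So V is where the director is
    not perpendicular to n0, and dividing p by the root of q leaves m or - m.\<close>
  define V where "V = U \<inter> q -` {0<..}"
  define n where "n x = q x powr (- 1 / 2) *\<^sub>R p x" for x
  have VU: "V \<subseteq> U" by (simp add: V_def)
  have V: "open V"
    unfolding V_def by (intro continuous_open_preimage smooth_on_imp_continuous_on[OF sm_q] assms(1)) auto
  have main: "n x \<bullet> n x = 1 \<and> Q x = uniaxial_tensor (s x) (n x)" if x: "x \<in> V" for x
  proof -
    have xU: "x \<in> U" using x VU by blast
    obtain \<sigma> m where m: "m \<bullet> m = 1" "Q x = uniaxial_tensor \<sigma> m"
      using rep[OF xU] by blast
    have px: "p x = (m \<bullet> n0) *\<^sub>R m" by (rule p[OF xU m(2,1)])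
    then have qx: "q x = (m \<bullet> n0)\<^sup>2" by (simp add: q_def power2_eq_square)
    have nz: "m \<bullet> n0 \<noteq> 0" using x qx by (auto simp: V_def)
    have "q x powr (- 1 / 2) = inverse \<bar>m \<bullet> n0\<bar>"
      using qx by (simp add: powr_minus powr_half_sqrt)
    then have "n x = (inverse \<bar>m \<bullet> n0\<bar> * (m \<bullet> n0)) *\<^sub>R m"
      by (simp add: n_def px)
    then have "n x = m \<or> n x = - m"
      using nz by (auto simp: abs_if)
    then show ?thesis
      using m s_eq[OF m(2,1)] by (auto simp: uniaxial_tensor_minus)
  qed
  have "x0 \<in> V"
    using p[OF assms(5) n0(2,1)] n0(1) assms(5) by (simp add: V_def q_def)
  have "smooth_on n V"
    unfolding n_def
    by (rule smooth_on_scaleR[OF V smooth_on_powr[OF V _ smooth_on_subset[OF sm_q VU]] smooth_on_subset[OF sm_p VU]])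
      (simp add: V_def)
  note sm = smooth_on_subset[OF sm_s VU] this
  show ?thesis
  proof (rule that[OF V \<open>x0 \<in> V\<close> VU sm])
    show "\<forall>x\<in>V. n x \<bullet> n x = 1 \<and> s x \<noteq> 0 \<and> Q x = uniaxial_tensor (s x) (n x)"
      using main s0 VU by blast
  qed
qed

text \<open>The first derivative of an entry has the shape of the contracted identity with a = b = 0
  and the derivatives of n and s in place of l and k. Contraction with (n, n) kills the derivative
  of s; contraction with the derivative of n and n then kills the derivative of n.\<close>

lemma uniaxial_invariant:
  fixes n :: "'a::real_normed_vector \<Rightarrow> real^3"
  assumes "open V" "smooth_on s V" "smooth_on n V"
    and unit: "\<And>x. x \<in> V \<Longrightarrow> n x \<bullet> n x = 1" and "\<And>x. x \<in> V \<Longrightarrow> s x \<noteq> 0"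
    and zero: "\<And>i j. dirderiv v (\<lambda>x. s x * (n x $ i * n x $ j + (if i = j then - 1 / 3 else 0))) x = 0"
    and x: "x \<in> V"
  shows "dirderiv v s x = 0" "dirderiv v n x = 0"
proof -
  have "n x \<bullet> dirderiv v n x = 0"
    using dirderiv_inner_const[OF assms(1,3,3) unit x, of v] by (simp add: inner_commute)
  moreover from this have "dirderiv v n x \<bullet> n x = 0" by (simp only: inner_commute)
  ultimately have perp: "n x \<bullet> dirderiv v n x = 0" "dirderiv v n x \<bullet> n x = 0" .
  have E: "s x * (dirderiv v n x $ i * n x $ j + n x $ i * dirderiv v n x $ j + 2 * ((0::real^3) $ i * (0::real^3) $ j) + 2 * ((0::real^3) $ i * (0::real^3) $ j))
      + 2 * 0 * ((0::real^3) $ i * n x $ j + n x $ i * (0::real^3) $ j) + 2 * 0 * ((0::real^3) $ i * n x $ j + n x $ i * (0::real^3) $ j)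
      + dirderiv v s x * (n x $ i * n x $ j + (if i = j then - 1 / 3 else 0)) = 0" for i j
    using zero[of i j] unfolding entry_dirderiv[OF assms(1-3) x] by (simp add: algebra_simps split del: if_split)
  note C = quadratic_form_contract[OF E]
  show s: "dirderiv v s x = 0"
    using C[of "n x" "n x"] unfolding unit[OF x] perp by simp
  show "dirderiv v n x = 0"
    using C[of "dirderiv v n x" "n x"] assms(5)[OF x] unfolding unit[OF x] perp s by simp
qed

lemma dirderiv2_cong:
  assumes "open S" "x \<in> S" "\<And>y. y \<in> S \<Longrightarrow> f y = g y"
  shows "dirderiv w (dirderiv v f) x = dirderiv w (dirderiv v g) x"
proof (rule dirderiv_cong[OF assms(1,2)])
  show "dirderiv v f y = dirderiv v g y" if "y \<in> S" for y
    using assms(3) by (intro dirderiv_cong[OF assms(1) that])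
qed

text \<open>The term along \<open>e 1\<close> differentiates a function that vanishes on S, so only
  the planar part of the Laplacian remains.\<close>

lemma tensor_laplacian_frame:
  fixes e :: "3 \<Rightarrow> real^3"
  assumes "\<And>v. v = (\<Sum>j\<in>UNIV. (v \<bullet> e j) *\<^sub>R e j)" "open S" "smooth_on Q S" "x \<in> S"
    and inv: "\<And>y. y \<in> S \<Longrightarrow> dirderiv (e 1) Q y = 0"
  shows "tensor_laplacian Q x $ i $ j = (\<Sum>k\<in>{2, 3}. dirderiv (e k) (dirderiv (e k) (\<lambda>y. Q y $ i $ j)) x)"
proof -
  have h: "bounded_linear (\<lambda>A :: real^3^3. A $ i $ j)"
    by (intro bounded_linear_compose[OF bounded_linear_vec_nth] bounded_linear_vec_nth)
  have "dirderiv (e 1) (dirderiv (e 1) Q) x = dirderiv (e 1) (\<lambda>y. 0) x"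
    by (rule dirderiv_cong[OF assms(2,4)]) (rule inv)
  then have "dirderiv (e 1) (dirderiv (e 1) (\<lambda>y. Q y $ i $ j)) x = 0"
    unfolding dirderiv_bounded_linear2[OF h assms(2-4)] by simp
  then show ?thesis
    unfolding tensor_laplacian_def vec_lambda_beta
      laplacian_frame[OF assms(1) assms(2) smooth_on_bounded_linear[OF h assms(2,3)] assms(4)]
    by (simp add: sum_3)
qed

lemma uniaxial_tensor_scaleR: "uniaxial_tensor \<sigma> n = \<sigma> *\<^sub>R uniaxial_tensor 1 n"
  by (simp add: uniaxial_tensor_def)

text \<open>The conclusion avoids s and n, which exist near x0 only and with an arbitrary sign; in
  this form it can be compared between balls.\<close>

lemma locally_constant_director:
  fixes Q :: "real^3 \<Rightarrow> real^3^3"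
  assumes "L \<noteq> 0" "open \<Omega>" "smooth_on Q \<Omega>" "equilibrium_eq L \<phi> Q \<Omega>" "norm \<nu> = 1"
    and inv: "\<And>y. y \<in> \<Omega> \<Longrightarrow> dirderiv \<nu> Q y = 0"
    and uni: "\<And>x. x \<in> \<Omega> \<Longrightarrow> Q x \<in> uniaxial"
    and x0: "x0 \<in> \<Omega>" "Q x0 \<noteq> 0"
  obtains d n0 where "d > 0" "ball x0 d \<subseteq> {x \<in> \<Omega>. Q x \<noteq> 0}" "norm n0 = 1"
    "\<forall>x\<in>ball x0 d. \<exists>\<sigma>. Q x = uniaxial_tensor \<sigma> n0"
proof -
  let ?U = "{x \<in> \<Omega>. Q x \<noteq> 0}"
  obtain e :: "3 \<Rightarrow> real^3" where e: "e 1 = \<nu>" and frame: "\<And>v. v = (\<Sum>j\<in>UNIV. (v \<bullet> e j) *\<^sub>R e j)"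
    using orthonormal_frame[OF assms(5)] by blast
  have inv': "dirderiv (e 1) Q y = 0" if "y \<in> \<Omega>" for y
    unfolding e by (rule inv[OF that])
  have "open (\<Omega> \<inter> Q -` (- {0}))"
    by (intro continuous_open_preimage smooth_on_imp_continuous_on[OF assms(3)] assms(2)) auto
  moreover have "\<Omega> \<inter> Q -` (- {0}) = ?U" by auto
  ultimately have U: "open ?U" by simp
  have smU: "smooth_on Q ?U"
    by (rule smooth_on_subset[OF assms(3)]) auto
  have mem: "Q x \<in> uniaxial" "Q x \<noteq> 0" if "x \<in> ?U" for x
    using that uni by auto
  have x0U: "x0 \<in> ?U" using x0 by simp
  obtain V s n where V: "open V" "x0 \<in> V" "V \<subseteq> ?U" and sm: "smooth_on s V" "smooth_on n V"
    and sn: "\<forall>x\<in>V. n x \<bullet> n x = 1 \<and> s x \<noteq> 0 \<and> Q x = uniaxial_tensor (s x) (n x)"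
    by (rule smooth_director[OF U smU mem x0U])
  have unit: "n x \<bullet> n x = 1" and s: "s x \<noteq> 0" and Q: "Q x = uniaxial_tensor (s x) (n x)" if "x \<in> V" for x
    using bspec[OF sn that] by blast+
  have V\<Omega>: "x \<in> \<Omega>" if "x \<in> V" for x using that V(3) by blast
  obtain g where g: "\<And>x \<sigma> n. x \<in> \<Omega> \<Longrightarrow> n \<bullet> n = 1 \<Longrightarrow> Q x = uniaxial_tensor \<sigma> n \<Longrightarrow> tensor_laplacian Q x = g \<sigma> *\<^sub>R Q x"
    using uniaxial_equilibrium[OF assms(4,1)] by metis
  \<comment> \<open>The formula agrees with an entry of Q on V only; since V is open, derivatives
    there agree as well.\<close>
  define q where "q i j y = s y * (n y $ i * n y $ j + (if i = j then - 1 / 3 else 0))" for i j y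
  have q: "q i j y = Q y $ i $ j" if "y \<in> V" for i j y
    by (simp only: Q[OF that] uniaxial_tensor_nth q_def)
  have zero: "dirderiv (e 1) (q i j) x = 0" if "x \<in> V" for i j x
  proof -
    have h: "bounded_linear (\<lambda>A :: real^3^3. A $ i $ j)"
      by (intro bounded_linear_compose[OF bounded_linear_vec_nth] bounded_linear_vec_nth)
    have "dirderiv (e 1) (q i j) x = dirderiv (e 1) (\<lambda>y. Q y $ i $ j) x"
      by (rule dirderiv_cong[OF V(1) that q])
    then show ?thesis
      by (simp add: dirderiv_bounded_linear[OF h assms(3) V\<Omega>[OF that]] inv'[OF V\<Omega>[OF that]])
  qed
  have inv_sn: "dirderiv (e 1) s x = 0" "dirderiv (e 1) n x = 0" if "x \<in> V" for x
    by (rule uniaxial_invariant[OF V(1) sm unit s zero[unfolded q_def, OF that] that]; assumption)+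
  have lap: "(\<Sum>k\<in>{2, 3}. dirderiv (e k) (dirderiv (e k) (q i j)) x) = g (s x) * q i j x" if x: "x \<in> V" for i j x
  proof -
    have "(\<Sum>k\<in>{2, 3}. dirderiv (e k) (dirderiv (e k) (q i j)) x)
      = (\<Sum>k\<in>{2, 3}. dirderiv (e k) (dirderiv (e k) (\<lambda>y. Q y $ i $ j)) x)"
      by (intro sum.cong refl dirderiv2_cong[OF V(1) x] q)
    also have "\<dots> = tensor_laplacian Q x $ i $ j"
      by (rule tensor_laplacian_frame[OF frame assms(2,3) V\<Omega>[OF x] inv', symmetric])
    also have "\<dots> = g (s x) * q i j x"
      unfolding g[OF V\<Omega>[OF x] unit[OF x] Q[OF x]] by (simp add: q[OF x])
    finally show ?thesis .
  qed
  have const: "dirderiv v n x = 0" if "x \<in> V" for v x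
    by (rule director_locally_constant[OF V(1) sm unit s frame inv_sn lap[unfolded q_def] that])
  obtain d where d: "d > 0" "ball x0 d \<subseteq> V"
    using V openE by blast
  show ?thesis
  proof (rule that[OF d(1), of "n x0"])
    show "ball x0 d \<subseteq> ?U" using d V by blast
    show "norm (n x0) = 1" using unit[OF V(2)] by (simp add: norm_eq_1)
    show "\<forall>x\<in>ball x0 d. \<exists>\<sigma>. Q x = uniaxial_tensor \<sigma> (n x0)"
    proof
      fix x assume x: "x \<in> ball x0 d"
      have "n x = n x0"
        by (rule smooth_constant_on_ball[OF smooth_on_subset[OF sm(2) d(2)] const x]) (use d in blast)
      moreover have "x \<in> V" using x d(2) by blast
      ultimately show "\<exists>\<sigma>. Q x = uniaxial_tensor \<sigma> (n x0)"
        using Q by metis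
    qed
  qed
qed

section \<open>Propagation of the director\<close>

text \<open>Proportionality to T is expressed by the 2 x 2 minors against one fixed nonzero entry of
  T. Each minor is linear in Q, hence real analytic, and vanishes on the ball.\<close>

lemma director_extends_analytic:
  assumes an: "real_analytic_on Q \<Omega>" "connected \<Omega>" and x0: "x0 \<in> \<Omega>" "d > 0"
    and n0: "n0 \<bullet> n0 = 1" and uni: "\<And>x. x \<in> ball x0 d \<Longrightarrow> \<exists>\<sigma>. Q x = uniaxial_tensor \<sigma> n0"
    and y: "y \<in> \<Omega>"
  shows "\<exists>\<sigma>. Q y = uniaxial_tensor \<sigma> n0"
proof -
  define T where "T = uniaxial_tensor 1 n0"
  have "T \<noteq> 0" using uniaxial_tensor_eq_0_iff[OF n0, of 1] by (simp add: T_def)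
  then obtain k l where kl: "T $ k $ l \<noteq> 0" by (auto simp: vec_eq_iff)
  have "Q y $ i $ j * T $ k $ l - Q y $ k $ l * T $ i $ j = 0" for i j
  proof -
    have ent: "bounded_linear (\<lambda>A :: real^3^3. A $ i $ j)" for i j
      by (intro bounded_linear_compose[OF bounded_linear_vec_nth] bounded_linear_vec_nth)
    have h: "bounded_linear (\<lambda>A :: real^3^3. A $ i $ j * T $ k $ l - A $ k $ l * T $ i $ j)"
      by (intro bounded_linear_sub bounded_linear_mult_const ent)
    show ?thesis
    proof (rule real_analytic_on_identity[OF real_analytic_on_bounded_linear[OF h an(1)] an(2) x0 _ y])
      fix x assume "x \<in> ball x0 d"
      then obtain \<sigma> where "Q x = \<sigma> *\<^sub>R T"
        using uni uniaxial_tensor_scaleR unfolding T_def by metis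
      then show "Q x $ i $ j * T $ k $ l - Q x $ k $ l * T $ i $ j = 0" by simp
    qed
  qed
  then have "Q y = (Q y $ k $ l / T $ k $ l) *\<^sub>R T"
    using kl by (simp add: vec_eq_iff field_simps)
  then show ?thesis using uniaxial_tensor_scaleR unfolding T_def by metis
qed

theorem theorem4p1:
  fixes L :: real
    and \<phi> :: "real \<Rightarrow> real \<Rightarrow> real"
    and \<Omega> :: "(real^3) set"
    and Q :: "real^3 \<Rightarrow> real^3^3"
    and \<nu>0 :: "real^3"
  assumes "L > 0"
    and "\<And>a b. \<phi> a b \<ge> 0"
    and "smooth_on (\<lambda>(a, b). \<phi> a b) UNIV"
    and "open \<Omega>"
    and "\<And>x. x \<in> \<Omega> \<Longrightarrow> Q x \<in> sym_traceless"
    and "smooth_on Q \<Omega>"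
    and "equilibrium_eq L \<phi> Q \<Omega>"
    and "\<nu>0 \<in> sphere 0 1"
    and "\<And>x. x \<in> \<Omega> \<Longrightarrow> (\<Sum>k\<in>UNIV. \<nu>0 $ k *\<^sub>R partial_deriv k Q x) = 0"
  shows "((\<forall>x\<in>\<Omega>. Q x \<in> uniaxial) \<longrightarrow>
           (\<forall>\<omega>\<in>components {x\<in>\<Omega>. Q x \<noteq> 0}.
              \<exists>n0\<in>sphere 0 1. \<exists>s :: real^3 \<Rightarrow> real. \<forall>x\<in>\<omega>. Q x = uniaxial_tensor (s x) n0)) \<and>
         ((\<forall>x\<in>\<Omega>. Q x \<in> uniaxial) \<and> real_analytic_on Q \<Omega> \<and> connected \<Omega> \<longrightarrow>
           (\<exists>n0\<in>sphere 0 1. \<exists>s :: real^3 \<Rightarrow> real. \<forall>x\<in>\<Omega>. Q x = uniaxial_tensor (s x) n0))"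
proof -
  let ?U = "{x\<in>\<Omega>. Q x \<noteq> 0}"
  have L: "L \<noteq> 0" and \<nu>: "norm \<nu>0 = 1" using assms(1,8) by auto
  have inv: "dirderiv \<nu>0 Q x = 0" if x: "x \<in> \<Omega>" for x
  proof -
    note lin = linear_dirderiv[OF assms(6) x]
    have "\<nu>0 = (\<Sum>k\<in>UNIV. (\<nu>0 $ k) *\<^sub>R axis k 1)"
      by (simp add: vec_eq_iff axis_def if_distrib sum.delta cong: if_cong)
    then have "dirderiv \<nu>0 Q x = dirderiv (\<Sum>k\<in>UNIV. (\<nu>0 $ k) *\<^sub>R axis k 1) Q x"
      by (rule arg_cong)
    also have "\<dots> = (\<Sum>k\<in>UNIV. \<nu>0 $ k *\<^sub>R partial_deriv k Q x)"
      by (simp add: linear_sum[OF lin] linear_scale[OF lin] partial_deriv_def dirderiv_def[symmetric])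
    finally show ?thesis using assms(9)[OF x] by simp
  qed
  note local = locally_constant_director[OF L assms(4,6,7) \<nu> inv]
  have part1: "\<exists>n0\<in>sphere 0 1. \<exists>s :: real^3 \<Rightarrow> real. \<forall>x\<in>\<omega>. Q x = uniaxial_tensor (s x) n0"
    if uni: "\<forall>x\<in>\<Omega>. Q x \<in> uniaxial" and \<omega>: "\<omega> \<in> components ?U" for \<omega>
  proof -
    have sub: "\<omega> \<subseteq> ?U" using in_components_subset[OF \<omega>] .
    obtain x0 where x0: "x0 \<in> \<omega>" using in_components_nonempty[OF \<omega>] by blast
    then have "Q x0 \<in> uniaxial" using uni sub by blast
    \<comment> \<open>The director at one point serves as n0; connectedness carries its line through
      the component.\<close>
    then obtain \<sigma>0 n0 where n0: "n0 \<in> sphere 0 1" "Q x0 = uniaxial_tensor \<sigma>0 n0"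
      by (auto simp: uniaxial_def)
    have "\<exists>\<sigma>. Q x = uniaxial_tensor \<sigma> n0" if x: "x \<in> \<omega>" for x
    proof (rule connected_induction_simple[OF in_components_connected[OF \<omega>], of x0 x "\<lambda>x. \<exists>\<sigma>. Q x = uniaxial_tensor \<sigma> n0"])
      fix a assume a: "a \<in> \<omega>"
      then have a': "a \<in> \<Omega>" "Q a \<noteq> 0" using sub by auto
      obtain d m where d: "d > 0" "ball a d \<subseteq> ?U" "norm m = 1"
        and dir: "\<forall>y\<in>ball a d. \<exists>\<sigma>. Q y = uniaxial_tensor \<sigma> m"
        by (rule local[OF _ bspec[OF uni] a'])
      have "\<exists>\<sigma>. Q z = uniaxial_tensor \<sigma> n0"
        if y: "y \<in> \<omega> \<inter> ball a d" and z: "z \<in> \<omega> \<inter> ball a d" and w: "\<exists>\<sigma>. Q y = uniaxial_tensor \<sigma> n0" for y z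
      proof -
        obtain \<sigma> where \<sigma>: "Q y = \<sigma> *\<^sub>R uniaxial_tensor 1 n0"
          using w uniaxial_tensor_scaleR by metis
        obtain \<alpha> where \<alpha>: "Q y = \<alpha> *\<^sub>R uniaxial_tensor 1 m"
          using bspec[OF dir IntD2[OF y]] uniaxial_tensor_scaleR by metis
        obtain \<beta> where \<beta>: "Q z = \<beta> *\<^sub>R uniaxial_tensor 1 m"
          using bspec[OF dir IntD2[OF z]] uniaxial_tensor_scaleR by metis
        \<comment> \<open>As Q y is nonzero, the lines through the tensors of m and n0 coincide, so
          Q z, lying on the first, lies on the second.\<close>
        have "\<alpha> \<noteq> 0" using \<alpha> y sub by auto
        then have "uniaxial_tensor 1 m = (1 / \<alpha>) *\<^sub>R Q y" by (simp add: \<alpha>)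
        then have "Q z = (\<beta> / \<alpha> * \<sigma>) *\<^sub>R uniaxial_tensor 1 n0" by (simp add: \<beta> \<sigma>)
        then show ?thesis using uniaxial_tensor_scaleR by metis
      qed
      moreover have "openin (top_of_set \<omega>) (\<omega> \<inter> ball a d)"
        by (simp add: openin_open_Int)
      moreover have "a \<in> \<omega> \<inter> ball a d" using a d(1) by simp
      ultimately show "\<exists>T. openin (top_of_set \<omega>) T \<and> a \<in> T \<and> (\<forall>x\<in>T. \<forall>y\<in>T.
          (\<exists>\<sigma>. Q x = uniaxial_tensor \<sigma> n0) \<longrightarrow> (\<exists>\<sigma>. Q y = uniaxial_tensor \<sigma> n0))"
        by (intro exI[of _ "\<omega> \<inter> ball a d"] conjI ballI impI)
    qed (use x x0 n0 in blast)+
    then have "\<exists>s. \<forall>x\<in>\<omega>. Q x = uniaxial_tensor (s x) n0" by (intro bchoice) blast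
    with n0(1) show ?thesis by blast
  qed
  have part2: "\<exists>n0\<in>sphere 0 1. \<exists>s :: real^3 \<Rightarrow> real. \<forall>x\<in>\<Omega>. Q x = uniaxial_tensor (s x) n0"
    if uni: "\<forall>x\<in>\<Omega>. Q x \<in> uniaxial" and an: "real_analytic_on Q \<Omega>" "connected \<Omega>"
  proof (cases "?U = {}")
    case True
    \<comment> \<open>When Q vanishes identically, any unit vector is a director; \<nu>0 is one at
      hand.\<close>
    then have "Q x = uniaxial_tensor 0 \<nu>0" if "x \<in> \<Omega>" for x
      using that by (auto simp: uniaxial_tensor_def)
    with assms(8) show ?thesis by (intro bexI[of _ \<nu>0] exI[of _ "\<lambda>x. 0"]) auto
  next
    case False
    then obtain x0 where x0: "x0 \<in> \<Omega>" "Q x0 \<noteq> 0" by blast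
    obtain d n0 where d: "d > 0" "ball x0 d \<subseteq> ?U" and n0: "norm n0 = 1"
      and dir: "\<forall>x\<in>ball x0 d. \<exists>\<sigma>. Q x = uniaxial_tensor \<sigma> n0"
      by (rule local[OF _ bspec[OF uni] x0])
    have "n0 \<bullet> n0 = 1" using n0 by (simp add: norm_eq_1)
    from director_extends_analytic[OF an x0(1) d(1) this bspec[OF dir]]
    have "\<exists>s. \<forall>x\<in>\<Omega>. Q x = uniaxial_tensor (s x) n0" by (intro bchoice) blast
    then show ?thesis using n0 by (intro bexI[of _ n0]) auto
  qed
  show ?thesis using part1 part2 by blast
qed

end
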